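(* Let $p>1$ and $h\in(0,1]$ be constants with $ph>1$, let $T>0$, and let $(X_t)_{t\in[0,T]}$ be a random process, with each $X_t$ integrable, on a filtered probability space $(\Omega,\{\mathcal{F}_t\},\mathcal{F},\mathbb{P})$ satisfying the usual conditions, such that $$\mathbb{E}\left(\left|\mathbb{E}(X_t\mid\mathcal{F}_s)-X_s\right|^p\right)\le A_{p,h}|t-s|^{ph}\qquad\text{for all }0\le s<t\le T,$$ where $A_{p,h}$ is a constant depending only on $p$ and $h$. Let $0\le s_0<t_0\le T$ and let $X^{*}=\sup_{u\in[s_0,t_0]}|X_u|$. Then for any $1<q\le p$, $$\|X^{*}\|_{L^q}\le\frac{q}{q-1}\left[C_{p,h,\theta}^{1/p}A_{p,h}^{1/p}|t_0-s_0|^{h}+\|X_{t_0}\|_{L^q}\right],$$ where, for an arbitrary constant $\theta>1$, $$C_{p,h,\theta}=\kappa_p\,[2\zeta(\theta)]^{p-1}\left(\frac{p}{p-1}\right)^{p}\left(\frac{4}{ph-1}\right)^{\theta(p-1)+1}\Gamma\left[\theta(p-1)+1\right]$$ and $\kappa_p$ is a multiple depending only on $p$.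
   Context: $\zeta(\theta)=\sum_{m=1}^{\infty}m^{-\theta}$ is the Riemann zeta function and $\Gamma$ is the Gamma function. The usual conditions mean that the filtration is right-continuous and complete. $\|\cdot\|_{L^q}$ is the norm of $L^q(\Omega,\mathcal{F},\mathbb{P})$.
   Formalization: The process is additionally assumed separable in Doob's sense (e.g. right-continuous paths), since the claim fails for X_u = 1{u=U} with U uniform; and κ_p is chosen for all probability spaces on a given underlying set, from which a universal κ_p follows by a disjoint-union argument. *)

theory Defs
  imports "HOL-Probability.Probability"
begin

definition riemann_zeta :: "real \<Rightarrow> real" where
  "riemann_zeta \<theta> = (\<Sum>m. real (Suc m) powr (- \<theta>))"

text \<open>The norm of \<open>L\<^sup>q\<close> for \<open>[0,\<infinity>]\<close>-valued functions takes values in \<open>[0,\<infinity>]\<close>, so that it is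
  \<open>\<infinity>\<close>, and not a junk value, for functions outside \<open>L\<^sup>q\<close>. The power is only meant for
  exponents \<open>a > 0\<close>.\<close>

definition ennreal_powr :: "ennreal \<Rightarrow> real \<Rightarrow> ennreal" where
  "ennreal_powr x a = (if x = \<infinity> then \<infinity> else ennreal (enn2real x powr a))"

definition Lq_norm :: "'a measure \<Rightarrow> real \<Rightarrow> ('a \<Rightarrow> ennreal) \<Rightarrow> ennreal" where
  "Lq_norm M q f = ennreal_powr (\<integral>\<^sup>+ \<omega>. ennreal_powr (f \<omega>) q \<partial>M) (1 / q)"

text \<open>A filtered probability space, with time set \<open>{0..T}\<close>, satisfying the usual conditions; the values
  of \<open>F\<close> outside \<open>{0..T}\<close> are irrelevant.\<close>

definition usual_filtered_prob_space :: "'a measure \<Rightarrow> real \<Rightarrow> (real \<Rightarrow> 'a measure) \<Rightarrow> bool" where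
  "usual_filtered_prob_space M T F \<longleftrightarrow>
     prob_space M \<and>
     (\<forall>t\<in>{0..T}. subalgebra M (F t)) \<and>
     (\<forall>s\<in>{0..T}. \<forall>t\<in>{0..T}. s \<le> t \<longrightarrow> sets (F s) \<subseteq> sets (F t)) \<and>
     (\<forall>s\<in>{0..<T}. sets (F s) = (\<Inter>t\<in>{s<..T}. sets (F t))) \<and>
     complete_measure M \<and> null_sets M \<subseteq> sets (F 0)"

text \<open>Separability in the sense of Doob: almost surely, the graph of the path over a fixed countable
  set of times is dense in the graph of the path. This is the regularity under which a supremum
  over an uncountable set of times is determined, up to null sets, by the finite-dimensional
  distributions; processes with right-continuous paths have it.\<close>

definition separable_process :: "'a measure \<Rightarrow> real \<Rightarrow> (real \<Rightarrow> 'a \<Rightarrow> real) \<Rightarrow> bool" where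
  "separable_process M T X \<longleftrightarrow>
     (\<exists>D. countable D \<and> D \<subseteq> {0..T} \<and>
        (AE \<omega> in M. \<forall>u\<in>{0..T}. (u, X u \<omega>) \<in> closure ((\<lambda>d. (d, X d \<omega>)) ` D)))"

lemma separable_process_right_continuous:
  assumes "AE \<omega> in M. \<forall>u\<in>{0..<T}. ((\<lambda>t. X t \<omega>) \<longlongrightarrow> X u \<omega>) (at_right u)"
  shows "separable_process M T X"
proof -
  define D where "D = {0..T} \<inter> (\<rat> \<union> {T})"
  have "(u, X u \<omega>) \<in> closure ((\<lambda>d. (d, X d \<omega>)) ` D)"
    if c: "\<forall>u\<in>{0..<T}. ((\<lambda>t. X t \<omega>) \<longlongrightarrow> X u \<omega>) (at_right u)" and u: "u \<in> {0..T}" for \<omega> u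
  proof (cases "u = T")
    case True
    then have "u \<in> D" using u by (auto simp: D_def)
    then show ?thesis by (intro subsetD[OF closure_subset]) auto
  next
    case False
    then have u': "u \<in> {0..<T}" using u by auto
    have lim: "((\<lambda>t. (t, X t \<omega>)) \<longlongrightarrow> (u, X u \<omega>)) (at_right u)"
      using c u' by (intro tendsto_Pair) auto
    show ?thesis unfolding closure_iff_nhds_not_empty
    proof (intro allI impI)
      fix A V assume "V \<subseteq> A" "open V" "(u, X u \<omega>) \<in> V"
      then have "eventually (\<lambda>t. (t, X t \<omega>) \<in> V) (at_right u)"
        using lim by (simp add: topological_tendstoD)
      then obtain b where b: "u < b" "\<And>t. u < t \<Longrightarrow> t < b \<Longrightarrow> (t, X t \<omega>) \<in> V"
        by (auto simp: eventually_at_right_field)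
      obtain r where r: "r \<in> \<rat>" "u < r" "r < min b T"
        using Rats_dense_in_real[of u "min b T"] b u' by auto
      then have "r \<in> D" "(r, X r \<omega>) \<in> V" using b u' by (auto simp: D_def)
      then show "(\<lambda>d. (d, X d \<omega>)) ` D \<inter> A \<noteq> {}" using \<open>V \<subseteq> A\<close> by blast
    qed
  qed
  moreover have "countable D" unfolding D_def using countable_rat by auto
  moreover have "D \<subseteq> {0..T}" by (auto simp: D_def)
  ultimately show ?thesis
    unfolding separable_process_def using assms by (intro exI[of _ D]) (auto elim!: eventually_mono)
qed

lemma separable_process_measurable_SUP:
  assumes "complete_measure M" and sep: "separable_process M T X"
    and X: "\<And>t. t \<in> {0..T} \<Longrightarrow> X t \<in> borel_measurable M"
    and st: "0 \<le> s" "s \<le> t" "t \<le> T"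
  shows "(\<lambda>\<omega>. SUP u\<in>{s..t}. ennreal \<bar>X u \<omega>\<bar>) \<in> borel_measurable M"
proof -
  interpret complete_measure M by fact
  obtain D where D: "countable D" "D \<subseteq> {0..T}"
    and ae: "AE \<omega> in M. \<forall>u\<in>{0..T}. (u, X u \<omega>) \<in> closure ((\<lambda>d. (d, X d \<omega>)) ` D)"
    using sep by (auto simp: separable_process_def)
  define E where "E = {s, t} \<union> (D \<inter> {s..t})"
  have E: "countable E" "E \<subseteq> {s..t}" using D st by (auto simp: E_def)
  let ?f = "\<lambda>\<omega>. SUP u\<in>{s..t}. ennreal \<bar>X u \<omega>\<bar>" and ?g = "\<lambda>\<omega>. SUP u\<in>E. ennreal \<bar>X u \<omega>\<bar>"
  have g: "?g \<in> borel_measurable M"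
  proof (rule borel_measurable_SUP[OF E(1)])
    fix u assume "u \<in> E"
    then have [measurable]: "X u \<in> borel_measurable M" using E st by (intro X) auto
    show "(\<lambda>\<omega>. ennreal \<bar>X u \<omega>\<bar>) \<in> borel_measurable M" by measurable
  qed
  have eq: "?f \<omega> = ?g \<omega>" if d: "\<forall>u\<in>{0..T}. (u, X u \<omega>) \<in> closure ((\<lambda>d. (d, X d \<omega>)) ` D)" for \<omega>
  proof (rule antisym)
    show "?g \<omega> \<le> ?f \<omega>" using E by (intro SUP_subset_mono) auto
    show "?f \<omega> \<le> ?g \<omega>"
    proof (rule SUP_least)
      fix u assume u: "u \<in> {s..t}"
      show "ennreal \<bar>X u \<omega>\<bar> \<le> ?g \<omega>"
      proof (cases "u \<in> E")
        case True then show ?thesis by (intro SUP_upper) auto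
      next
        case False
        then have u': "s < u" "u < t" using u by (auto simp: E_def)
        let ?S = "(\<lambda>d. (d, X d \<omega>)) ` D" and ?U = "{s<..<t} \<times> (UNIV :: real set)"
        have "(u, X u \<omega>) \<in> ?U \<inter> closure ?S" using d u' st by auto
        then have "(u, X u \<omega>) \<in> closure (?U \<inter> ?S)"
          using open_Int_closure_subset[of ?U ?S] by (auto simp: open_Times)
        also have "\<dots> \<subseteq> {x. ennreal \<bar>snd x\<bar> \<le> ?g \<omega>}"
        proof (rule closure_minimal)
          show "?U \<inter> ?S \<subseteq> {x. ennreal \<bar>snd x\<bar> \<le> ?g \<omega>}"
          proof
            fix x assume "x \<in> ?U \<inter> ?S"
            then obtain d where "d \<in> E" "snd x = X d \<omega>" by (force simp: E_def)
            then show "x \<in> {x. ennreal \<bar>snd x\<bar> \<le> ?g \<omega>}" by (auto intro: SUP_upper)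
          qed
          show "closed {x :: real \<times> real. ennreal \<bar>snd x\<bar> \<le> ?g \<omega>}"
            by (intro closed_Collect_le continuous_on_ennreal continuous_intros)
        qed
        finally show ?thesis by simp
      qed
    qed
  qed
  have "AE \<omega> in M. ?g \<omega> = ?f \<omega>" using ae by eventually_elim (simp only: eq)
  then obtain N where N: "N \<in> null_sets M" "{\<omega> \<in> space M. ?g \<omega> \<noteq> ?f \<omega>} \<subseteq> N"
    by (auto elim!: AE_E simp: null_sets_def)
  show ?thesis
  proof (rule measurableI)
    fix A :: "ennreal set" assume A: "A \<in> sets borel"
    let ?G = "?g -` A \<inter> space M"
    have "?G \<in> sets M" using g A by (rule measurable_sets)
    then have "?G - N \<in> sets M" "?G \<union> N \<in> sets M" using N by auto
    moreover have "N \<inter> (?f -` A \<inter> space M) \<in> sets M"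
      using complete[of "N \<inter> (?f -` A \<inter> space M)" N] N by auto
    moreover have "?f -` A \<inter> space M = (?G - N) \<union> (N \<inter> (?f -` A \<inter> space M))"
      using N(2) by (auto; metis (mono_tags, lifting) mem_Collect_eq subsetD)
    ultimately show "?f -` A \<inter> space M \<in> sets M" by (metis sets.Un)
  qed simp
qed

definition C_const :: "real \<Rightarrow> real \<Rightarrow> real \<Rightarrow> real \<Rightarrow> real" where
  "C_const \<kappa> p h \<theta> =
     \<kappa> * (2 * riemann_zeta \<theta>) powr (p - 1) * (p / (p - 1)) powr p *
     (4 / (p * h - 1)) powr (\<theta> * (p - 1) + 1) * Gamma (\<theta> * (p - 1) + 1)"

end

theory Submission
  imports Defs
begin

text \<open>
  Chaining along dyadic points of \<open>[s\<^sub>0, t\<^sub>0]\<close>, from coarse to fine, writes \<open>X\<^sub>u\<close> as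
  \<open>\<bbbE>(X\<^bsub>t\<^sub>0\<^esub> | F\<^sub>u)\<close> minus conditional expectations of the increments
  \<open>\<bbbE>(X\<^sub>b | F\<^sub>a) - X\<^sub>a\<close> over neighbouring grid points \<open>a < b\<close>. Let \<open>R\<^sub>k\<close> be the \<open>\<ell>\<^sup>p\<close> norm
  of the \<open>2\<^sup>k\<close> increments of level \<open>k\<close>. Then \<open>\<bar>X\<^sub>u\<bar>\<close> is at most
  \<open>\<bbbE>(\<bar>X\<^bsub>t\<^sub>0\<^esub>\<bar> + \<Sum>\<^sub>k R\<^sub>k | F\<^sub>u)\<close> plus the increment from \<open>u\<close> to the next grid point, where the
  latter is taken outside the conditional expectation since \<open>X\<close> need not be adapted. The \<open>L\<^sup>p\<close>
  norms of the \<open>R\<^sub>k\<close> decay geometrically because \<open>p h > 1\<close>, and Doob's inequality bounds the supremum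
  of the martingale. An arbitrary finite set of \<open>m\<close> times costs one more
  increment per point; as soon as \<open>m \<le> 2\<^sup>n\<close>, all of them together are no larger than level \<open>n\<close> of the grid.
  Separability passes from finite sets to the whole interval.
\<close>

section \<open>Powers and norms with values in the extended reals\<close>

lemma ennreal_powr_ennreal [simp]: "0 \<le> x \<Longrightarrow> ennreal_powr (ennreal x) a = ennreal (x powr a)"
  by (simp add: ennreal_powr_def)

lemma ennreal_powr_top [simp]: "ennreal_powr \<infinity> a = \<infinity>" "ennreal_powr \<top> a = \<top>"
  by (simp_all add: ennreal_powr_def)

lemma ennreal_powr_0 [simp]: "ennreal_powr 0 a = 0"
  by (simp add: ennreal_powr_def)

lemma ennreal_powr_eq_0_iff [simp]: "ennreal_powr x a = 0 \<longleftrightarrow> x = 0"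
  by (cases x) (auto simp: ennreal_eq_0_iff)

lemma ennreal_powr_mono: "x \<le> y \<Longrightarrow> 0 < a \<Longrightarrow> ennreal_powr x a \<le> ennreal_powr y a"
  by (cases x; cases y) (auto simp: top_unique intro!: ennreal_leI powr_mono2)

lemma ennreal_powr_powr: "0 < a \<Longrightarrow> 0 < b \<Longrightarrow> ennreal_powr (ennreal_powr x a) b = ennreal_powr x (a * b)"
  by (cases x) (auto simp: powr_powr)

lemma ennreal_powr_one [simp]: "ennreal_powr x 1 = x"
  by (cases x) auto

text \<open>The powers with exponents \<open>a\<close> and \<open>1 / a\<close> are monotone and
  mutually inverse on \<open>[0, \<infinity>]\<close>. This is what turns bounds on norms into
  bounds on integrals.\<close>

lemma ennreal_powr_inverse_le_iff:
  assumes "0 < a"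
  shows "ennreal_powr x (1 / a) \<le> y \<longleftrightarrow> x \<le> ennreal_powr y a"
proof
  assume "ennreal_powr x (1 / a) \<le> y"
  from ennreal_powr_mono[OF this assms] show "x \<le> ennreal_powr y a"
    using assms by (simp add: ennreal_powr_powr)
next
  assume "x \<le> ennreal_powr y a"
  from ennreal_powr_mono[OF this, of "1 / a"] show "ennreal_powr x (1 / a) \<le> y"
    using assms by (simp add: ennreal_powr_powr)
qed

lemma measurable_ennreal_powr [measurable]: "(\<lambda>x. ennreal_powr x a) \<in> borel_measurable borel"
  unfolding ennreal_powr_def infinity_ennreal_def by measurable

lemma Lq_norm_le_iff:
  "0 < q \<Longrightarrow> Lq_norm M q f \<le> y \<longleftrightarrow> (\<integral>\<^sup>+ \<omega>. ennreal_powr (f \<omega>) q \<partial>M) \<le> ennreal_powr y q"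
  unfolding Lq_norm_def by (rule ennreal_powr_inverse_le_iff)

lemma ennreal_powr_Lq_norm:
  "0 < q \<Longrightarrow> ennreal_powr (Lq_norm M q f) q = (\<integral>\<^sup>+ \<omega>. ennreal_powr (f \<omega>) q \<partial>M)"
  by (simp add: Lq_norm_def ennreal_powr_powr)

lemma Lq_norm_mono_AE:
  "0 < q \<Longrightarrow> AE \<omega> in M. f \<omega> \<le> g \<omega> \<Longrightarrow> Lq_norm M q f \<le> Lq_norm M q g"
  unfolding Lq_norm_def
proof (intro ennreal_powr_mono nn_integral_mono_AE)
  assume q: "0 < q"
  assume "AE \<omega> in M. f \<omega> \<le> g \<omega>"
  then show "AE \<omega> in M. ennreal_powr (f \<omega>) q \<le> ennreal_powr (g \<omega>) q"
    by eventually_elim (rule ennreal_powr_mono[OF _ q])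
qed simp

lemma Lq_norm_eq_0_AE:
  assumes "0 < q" and [measurable]: "f \<in> borel_measurable M" and "Lq_norm M q f = 0"
  shows "AE \<omega> in M. f \<omega> = 0"
proof -
  have "(\<integral>\<^sup>+ \<omega>. ennreal_powr (f \<omega>) q \<partial>M) = 0"
    using ennreal_powr_Lq_norm[OF assms(1), of M f] assms(3) by simp
  then have "AE \<omega> in M. ennreal_powr (f \<omega>) q = 0"
    by (subst (asm) nn_integral_0_iff_AE) auto
  then show ?thesis
    by simp
qed

section \<open>Inequalities of Young, Minkowski and Lyapunov\<close>

lemma Young_powr:
  fixes q :: real
  assumes "1 < q" "0 \<le> a" "0 \<le> b"
  shows "a * b powr (q - 1) \<le> a powr q / q + (1 - 1 / q) * b powr q"
proof -
  have "a * b powr (q - 1) \<le> a powr q / q + (b powr (q - 1)) powr (q / (q - 1)) / (q / (q - 1))"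
    using assms by (intro Youngs_inequality) (auto simp: field_simps)
  moreover have "(b powr (q - 1)) powr (q / (q - 1)) / (q / (q - 1)) = (1 - 1 / q) * b powr q"
    using assms by (simp add: powr_powr) (simp add: field_simps)
  ultimately show ?thesis by simp
qed

text \<open>Follows from Young's inequality: with \<open>w = l * u + m * v\<close>, write
  \<open>w powr q\<close> as \<open>w * w powr (q - 1)\<close>, expand the first factor, apply
  \<open>Young_powr\<close> to both terms, and absorb the resulting share \<open>1 - 1 / q\<close>
  of \<open>w powr q\<close> on the left.\<close>

lemma powr_convex_combination:
  fixes q :: real
  assumes "1 < q" "0 \<le> l" "0 \<le> m" "l + m = 1" "0 \<le> u" "0 \<le> v"
  shows "(l * u + m * v) powr q \<le> l * u powr q + m * v powr q"
proof -
  define w where "w = l * u + m * v"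
  have w: "0 \<le> w" using assms by (simp add: w_def)
  have "w powr q = w * w powr (q - 1)"
    using w by (cases "w = 0") (auto simp: powr_diff)
  also have "\<dots> = l * (u * w powr (q - 1)) + m * (v * w powr (q - 1))"
    by (simp add: w_def algebra_simps)
  also have "\<dots> \<le> l * (u powr q / q + (1 - 1 / q) * w powr q) + m * (v powr q / q + (1 - 1 / q) * w powr q)"
    using assms w by (intro add_mono mult_left_mono Young_powr) auto
  also have "\<dots> = (l * u powr q + m * v powr q) / q + (l + m) * ((1 - 1 / q) * w powr q)"
    by (simp add: algebra_simps add_divide_distrib diff_divide_distrib)
  finally have "w powr q / q \<le> (l * u powr q + m * v powr q) / q"
    using assms by (simp add: algebra_simps)
  then show ?thesis using assms by (simp add: w_def divide_le_cancel)
qed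

text \<open>Minkowski's inequality by normalisation: if \<open>a\<close> and \<open>b\<close> are
  the norms, then \<open>(f + g) / (a + b)\<close> is the convex combination of \<open>f / a\<close>
  and \<open>g / b\<close> with weights \<open>a / (a + b)\<close> and \<open>b / (a + b)\<close>.
  Norms equal to zero or infinity do not allow this division and are treated apart.\<close>

lemma Lq_norm_triangle:
  assumes q: "1 < q" and [measurable]: "f \<in> borel_measurable M" "g \<in> borel_measurable M"
  shows "Lq_norm M q (\<lambda>\<omega>. f \<omega> + g \<omega>) \<le> Lq_norm M q f + Lq_norm M q g"
proof -
  consider "Lq_norm M q f = \<top> \<or> Lq_norm M q g = \<top>" | "Lq_norm M q f = 0" | "Lq_norm M q g = 0"
    | a b where "0 < a" "0 < b" "Lq_norm M q f = ennreal a" "Lq_norm M q g = ennreal b"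
    by (cases "Lq_norm M q f"; cases "Lq_norm M q g") (auto simp: less_eq_real_def)
  then show ?thesis
  proof cases
    case 2
    then have "AE \<omega> in M. f \<omega> = 0" using q by (intro Lq_norm_eq_0_AE) auto
    then have "Lq_norm M q (\<lambda>\<omega>. f \<omega> + g \<omega>) \<le> Lq_norm M q g" using q by (intro Lq_norm_mono_AE) auto
    then show ?thesis using 2 by simp
  next
    case 3
    then have "AE \<omega> in M. g \<omega> = 0" using q by (intro Lq_norm_eq_0_AE) auto
    then have "Lq_norm M q (\<lambda>\<omega>. f \<omega> + g \<omega>) \<le> Lq_norm M q f" using q by (intro Lq_norm_mono_AE) auto
    then show ?thesis using 3 by simp
  next
    case (4 a b)
    \<comment> \<open>The weights of the convex combination, rescaled by
      \<open>(a + b) powr q\<close> and by the normalising powers of \<open>a\<close> and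
      \<open>b\<close>. They are positive, so the pointwise bound extends to infinite
      values.\<close>
    define c where "c = (a + b) powr q * (a / (a + b)) / a powr q"
    define d where "d = (a + b) powr q * (b / (a + b)) / b powr q"
    have cd: "0 \<le> c" "0 \<le> d" using 4 by (auto simp: c_def d_def)
    have real: "(x + y) powr q \<le> c * x powr q + d * y powr q" if "0 \<le> x" "0 \<le> y" for x y
    proof -
      have *: "a / (a + b) + b / (a + b) = 1" using 4 by (simp flip: add_divide_distrib)
      have "((a / (a + b)) * (x / a) + (b / (a + b)) * (y / b)) powr q
          \<le> (a / (a + b)) * (x / a) powr q + (b / (a + b)) * (y / b) powr q"
        using q 4 that * by (intro powr_convex_combination) auto
      moreover have "(a / (a + b)) * (x / a) + (b / (a + b)) * (y / b) = (x + y) / (a + b)"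
      proof -
        have "(a / (a + b)) * (x / a) = x / (a + b)" "(b / (a + b)) * (y / b) = y / (a + b)"
          using 4 by auto
        then show ?thesis by (simp only: add_divide_distrib)
      qed
      ultimately have "((x + y) / (a + b)) powr q
          \<le> (a / (a + b)) * (x / a) powr q + (b / (a + b)) * (y / b) powr q" by simp
      then have "(a + b) powr q * ((x + y) / (a + b)) powr q
          \<le> (a + b) powr q * ((a / (a + b)) * (x / a) powr q + (b / (a + b)) * (y / b) powr q)"
        by (intro mult_left_mono) auto
      also have "\<dots> = c * x powr q + d * y powr q"
        using that 4 by (simp add: c_def d_def powr_divide distrib_left)
      finally show ?thesis using that 4 by (simp add: powr_divide)
    qed
    have pw: "ennreal_powr (x + y) q \<le> ennreal c * ennreal_powr x q + ennreal d * ennreal_powr y q" for x y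
    proof (cases "x = \<top> \<or> y = \<top>")
      case True
      have "0 < c" "0 < d" using 4 by (auto simp: c_def d_def)
      then show ?thesis using True by (auto simp: ennreal_mult_top ennreal_mult_eq_top_iff)
    next
      case False
      then obtain r s where "x = ennreal r" "0 \<le> r" "y = ennreal s" "0 \<le> s"
        by (cases x; cases y) auto
      moreover have "ennreal c * ennreal (r powr q) + ennreal d * ennreal (s powr q) = ennreal (c * r powr q + d * s powr q)"
        using cd by (simp add: ennreal_mult')
      moreover have "ennreal r + ennreal s = ennreal (r + s)"
        using calculation by simp
      ultimately show ?thesis using real[of r s]
        by (simp add: ennreal_leI del: ennreal_plus)
    qed
    have "(\<integral>\<^sup>+ \<omega>. ennreal_powr (f \<omega> + g \<omega>) q \<partial>M)
        \<le> (\<integral>\<^sup>+ \<omega>. ennreal c * ennreal_powr (f \<omega>) q + ennreal d * ennreal_powr (g \<omega>) q \<partial>M)"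
      by (intro nn_integral_mono pw)
    also have "\<dots> = ennreal c * ennreal (a powr q) + ennreal d * ennreal (b powr q)"
      using ennreal_powr_Lq_norm[of q M f] ennreal_powr_Lq_norm[of q M g] 4 q
      by (simp add: nn_integral_add nn_integral_cmult)
    also have "\<dots> = ennreal ((a + b) powr q * (a / (a + b) + b / (a + b)))"
    proof -
      have "ennreal c * ennreal (a powr q) + ennreal d * ennreal (b powr q) = ennreal (c * a powr q + d * b powr q)"
        using cd by (simp add: ennreal_mult')
      moreover have "c * a powr q = (a + b) powr q * (a / (a + b))" "d * b powr q = (a + b) powr q * (b / (a + b))"
        using 4 by (auto simp: c_def d_def)
      ultimately show ?thesis by (simp only: distrib_left)
    qed
    also have "a / (a + b) + b / (a + b) = 1" using 4 by (simp flip: add_divide_distrib)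
    finally have "Lq_norm M q (\<lambda>\<omega>. f \<omega> + g \<omega>) \<le> ennreal (a + b)"
      using 4 q by (subst Lq_norm_le_iff) (auto simp del: ennreal_plus)
    then show ?thesis using 4 by simp
  qed auto
qed

lemma Lq_norm_zero [simp]: "Lq_norm M q (\<lambda>\<omega>. 0) = 0"
  by (simp add: Lq_norm_def)

lemma Lq_norm_sum:
  assumes q: "1 < q" and "\<And>i. i \<in> I \<Longrightarrow> f i \<in> borel_measurable M"
  shows "Lq_norm M q (\<lambda>\<omega>. \<Sum>i\<in>I. f i \<omega>) \<le> (\<Sum>i\<in>I. Lq_norm M q (f i))"
  using assms(2)
proof (induction I rule: infinite_finite_induct)
  case (insert i I)
  have "Lq_norm M q (\<lambda>\<omega>. f i \<omega> + (\<Sum>i\<in>I. f i \<omega>)) \<le> Lq_norm M q (f i) + Lq_norm M q (\<lambda>\<omega>. \<Sum>i\<in>I. f i \<omega>)"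
    using insert by (intro Lq_norm_triangle q) auto
  also have "\<dots> \<le> Lq_norm M q (f i) + (\<Sum>i\<in>I. Lq_norm M q (f i))"
    using insert by (intro add_left_mono) auto
  finally show ?case using insert by simp
qed simp_all

text \<open>With \<open>a\<close> the norm of exponent \<open>p\<close>, Young's inequality against
  the constant 1 gives \<open>(x / a) powr q \<le> q / p * (x / a) powr p + (1 - q / p)\<close>.
  Integrating over a space of total mass 1 makes the right-hand side equal to 1.\<close>

lemma (in prob_space) Lq_norm_mono_exponent:
  assumes q: "0 < q" "q \<le> p" and [measurable]: "f \<in> borel_measurable M"
  shows "Lq_norm M q f \<le> Lq_norm M p f"
proof -
  consider "Lq_norm M p f = \<top>" | "Lq_norm M p f = 0" | a where "0 < a" "Lq_norm M p f = ennreal a"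
    by (cases "Lq_norm M p f") (auto simp: less_eq_real_def)
  then show ?thesis
  proof cases
    case 2
    then have "AE \<omega> in M. f \<omega> = 0" using q by (intro Lq_norm_eq_0_AE) auto
    then have "Lq_norm M q f \<le> Lq_norm M q (\<lambda>\<omega>. 0)" using q by (intro Lq_norm_mono_AE) auto
    then show ?thesis by simp
  next
    case (3 a)
    define c where "c = a powr q * (q / p) / a powr p"
    define d where "d = a powr q * (1 - q / p)"
    have cd: "0 \<le> c" "0 \<le> d" using 3 q by (auto simp: c_def d_def)
    have bound: "x powr q \<le> c * x powr p + d" if "0 \<le> x" for x
    proof (cases "x = 0")
      case True then show ?thesis using cd by simp
    next
      case False
      then have "((x / a) powr p) powr (q / p) * 1 powr (1 - q / p) \<le> q / p * (x / a) powr p + (1 - q / p) * 1"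
        using 3 q that by (intro Youngs_inequality_0) auto
      then have "a powr q * (x / a) powr q \<le> a powr q * (q / p * (x / a) powr p + (1 - q / p))"
        using q by (intro mult_left_mono) (auto simp: powr_powr)
      then show ?thesis using 3 that by (simp add: c_def d_def powr_divide algebra_simps)
    qed
    have pw: "ennreal_powr x q \<le> ennreal c * ennreal_powr x p + ennreal d" for x
    proof (cases x)
      case (real r)
      then show ?thesis using bound[of r] cd
        by (simp flip: ennreal_plus ennreal_mult')
    next
      case top
      have "0 < c" using 3 q by (auto simp: c_def)
      then show ?thesis using top by (auto simp: ennreal_mult_top ennreal_mult_eq_top_iff)
    qed
    have "(\<integral>\<^sup>+ \<omega>. ennreal_powr (f \<omega>) q \<partial>M) \<le> (\<integral>\<^sup>+ \<omega>. ennreal c * ennreal_powr (f \<omega>) p + ennreal d \<partial>M)"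
      by (intro nn_integral_mono pw)
    also have "\<dots> = ennreal c * ennreal (a powr p) + ennreal d"
      using ennreal_powr_Lq_norm[of p M f] 3 q
      by (simp add: nn_integral_add nn_integral_cmult emeasure_space_1)
    also have "\<dots> = ennreal (a powr q)"
    proof -
      have "ennreal c * ennreal (a powr p) + ennreal d = ennreal (c * a powr p + d)"
        using cd by (simp add: ennreal_mult')
      then show ?thesis using 3 by (simp add: c_def d_def right_diff_distrib)
    qed
    finally show ?thesis using 3 q by (subst Lq_norm_le_iff) auto
  qed auto
qed

lemma (in prob_space) integrable_powr_Lq_norm:
  assumes "0 < r" "r \<le> q" and [measurable]: "f \<in> borel_measurable M" and "Lq_norm M q (\<lambda>\<omega>. ennreal \<bar>f \<omega>\<bar>) < \<top>"
  shows "integrable M (\<lambda>\<omega>. \<bar>f \<omega>\<bar> powr r)"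
proof (rule integrableI_bounded)
  have "Lq_norm M r (\<lambda>\<omega>. ennreal \<bar>f \<omega>\<bar>) < \<top>"
    using Lq_norm_mono_exponent[OF assms(1,2), of "\<lambda>\<omega>. ennreal \<bar>f \<omega>\<bar>"] assms(4) by (simp add: order_le_less_trans)
  then have "ennreal_powr (Lq_norm M r (\<lambda>\<omega>. ennreal \<bar>f \<omega>\<bar>)) r < \<infinity>"
    by (cases "Lq_norm M r (\<lambda>\<omega>. ennreal \<bar>f \<omega>\<bar>)") auto
  then show "(\<integral>\<^sup>+ x. ennreal (norm (\<bar>f x\<bar> powr r)) \<partial>M) < \<infinity>"
    using assms(1) by (simp add: ennreal_powr_Lq_norm)
qed measurable

lemma (in prob_space) integrable_Lq_norm:
  assumes "1 \<le> q" and [measurable]: "f \<in> borel_measurable M" and "Lq_norm M q (\<lambda>\<omega>. ennreal \<bar>f \<omega>\<bar>) < \<top>"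
  shows "integrable M f"
  using integrable_powr_Lq_norm[of 1 q f] assms by (simp add: integrable_abs_iff)

text \<open>The power \<open>p\<close> undoes the outer root and leaves a sum of moments. Dominating
  a maximum over \<open>I\<close> by this \<open>l^p\<close> norm therefore costs only the factor
  \<open>card I powr (1 / p)\<close>.\<close>

lemma Lq_norm_sum_powr_le:
  fixes d :: real
  assumes p: "0 < p" and [measurable]: "\<And>i. i \<in> I \<Longrightarrow> f i \<in> borel_measurable M"
    and f: "\<And>i. i \<in> I \<Longrightarrow> (\<integral>\<^sup>+ \<omega>. ennreal (\<bar>f i \<omega>\<bar> powr p) \<partial>M) \<le> ennreal d" and "0 \<le> d"
  shows "Lq_norm M p (\<lambda>\<omega>. ennreal ((\<Sum>i\<in>I. \<bar>f i \<omega>\<bar> powr p) powr (1 / p)))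
    \<le> ennreal ((card I * d) powr (1 / p))"
proof -
  have "(\<integral>\<^sup>+ \<omega>. ennreal (\<Sum>i\<in>I. \<bar>f i \<omega>\<bar> powr p) \<partial>M) = (\<Sum>i\<in>I. \<integral>\<^sup>+ \<omega>. ennreal (\<bar>f i \<omega>\<bar> powr p) \<partial>M)"
    by (subst nn_integral_sum[symmetric]) auto
  also have "\<dots> \<le> (\<Sum>i\<in>I. ennreal d)" by (intro sum_mono f)
  also have "\<dots> = ennreal (card I * d)" using assms(4) by (simp add: ennreal_mult ennreal_of_nat_eq_real_of_nat)
  finally show ?thesis
    using assms by (subst Lq_norm_le_iff) (auto simp: powr_powr sum_nonneg)
qed

section \<open>Norms of countable suprema\<close>

lemma ennreal_powr_SUP_le:
  assumes "0 < q"
  shows "ennreal_powr (SUP i\<in>I. f i) q \<le> (SUP i\<in>I. ennreal_powr (f i) q)" (is "_ \<le> ?z")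
proof -
  have "f i \<le> ennreal_powr ?z (1 / q)" if "i \<in> I" for i
  proof -
    have "ennreal_powr (f i) q \<le> ?z" using that by (rule SUP_upper)
    then show ?thesis using ennreal_powr_inverse_le_iff[of "1 / q" "f i" ?z] assms by simp
  qed
  then have "(SUP i\<in>I. f i) \<le> ennreal_powr ?z (1 / q)" by (rule SUP_least)
  then show ?thesis using ennreal_powr_inverse_le_iff[of "1 / q" "SUP i\<in>I. f i" ?z] assms by simp
qed

text \<open>Monotone convergence along the finite initial segments of an enumeration of
  \<open>E\<close>.\<close>

lemma Lq_norm_SUP_countable_le:
  assumes q: "0 < q" and E: "countable E" and [measurable]: "\<And>u. u \<in> E \<Longrightarrow> f u \<in> borel_measurable M"
    and le: "\<And>U. finite U \<Longrightarrow> U \<subseteq> E \<Longrightarrow> Lq_norm M q (\<lambda>\<omega>. SUP u\<in>U. f u \<omega>) \<le> K"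
  shows "Lq_norm M q (\<lambda>\<omega>. SUP u\<in>E. f u \<omega>) \<le> K"
proof (cases "E = {}")
  case True then show ?thesis using le[of "{}"] by simp
next
  case False
  define U where "U = (\<lambda>n::nat. from_nat_into E ` {..n})"
  have U: "finite (U n)" "U n \<subseteq> E" for n using from_nat_into[OF False] by (auto simp: U_def)
  have EU: "E = (\<Union>n. U n)"
  proof
    show "E \<subseteq> (\<Union>n. U n)"
    proof
      fix u assume "u \<in> E"
      then obtain n where "from_nat_into E n = u" using from_nat_into_surj[OF E] by blast
      then have "u \<in> U n" by (auto simp: U_def)
      then show "u \<in> (\<Union>n. U n)" by blast
    qed
  qed (use U in blast)
  define g where "g = (\<lambda>n \<omega>. SUP u\<in>U n. f u \<omega>)"
  have [measurable]: "g n \<in> borel_measurable M" for n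
    unfolding g_def using U[of n] by (intro borel_measurable_SUP countable_finite) auto
  have inc: "g m \<omega> \<le> g n \<omega>" if "m \<le> n" for m n \<omega>
    unfolding g_def using that by (intro SUP_subset_mono) (auto simp: U_def)
  have "(\<integral>\<^sup>+ \<omega>. ennreal_powr (SUP u\<in>E. f u \<omega>) q \<partial>M) \<le> (\<integral>\<^sup>+ \<omega>. (SUP n. ennreal_powr (g n \<omega>) q) \<partial>M)"
  proof (rule nn_integral_mono)
    fix \<omega>
    have "(SUP u\<in>E. f u \<omega>) = (SUP n. g n \<omega>)"
      unfolding EU g_def by (simp add: SUP_UNION)
    then show "ennreal_powr (SUP u\<in>E. f u \<omega>) q \<le> (SUP n. ennreal_powr (g n \<omega>) q)"
      using ennreal_powr_SUP_le[OF q, of "\<lambda>n. g n \<omega>" UNIV] by simp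
  qed
  also have "\<dots> = (SUP n. \<integral>\<^sup>+ \<omega>. ennreal_powr (g n \<omega>) q \<partial>M)"
    by (intro nn_integral_monotone_convergence_SUP incseq_SucI le_funI ennreal_powr_mono inc q) auto
  also have "\<dots> \<le> ennreal_powr K q"
    using le[OF U] q by (intro SUP_least) (auto simp: g_def Lq_norm_le_iff)
  finally show ?thesis using q by (simp add: Lq_norm_le_iff)
qed

section \<open>Doob's inequality\<close>

lemma (in prob_space) sigma_finite_subalgebraI: "subalgebra M G \<Longrightarrow> sigma_finite_subalgebra M G"
  by (rule finite_measure_subalgebra_is_sigma_finite)
    (simp add: finite_measure_subalgebra_def finite_measure_subalgebra_axioms_def finite_measure_axioms)

text \<open>The a priori finiteness behind Doob's inequality, whose proof subtracts a fraction of
  the moment that is being estimated.\<close>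

lemma (in prob_space) integrable_powr_real_cond_exp:
  assumes G: "subalgebra M G" and q: "1 \<le> q"
    and [measurable]: "W \<in> borel_measurable M" and W: "\<And>\<omega>. 0 \<le> W \<omega>" "Lq_norm M q (\<lambda>\<omega>. ennreal (W \<omega>)) < \<top>"
  shows "integrable M (\<lambda>\<omega>. \<bar>real_cond_exp M G W \<omega>\<bar> powr q)"
proof -
  interpret sigma_finite_subalgebra M G by (rule sigma_finite_subalgebraI[OF G])
  have W': "Lq_norm M q (\<lambda>\<omega>. ennreal \<bar>W \<omega>\<bar>) < \<top>" using W by simp
  have intW: "integrable M W" by (rule integrable_Lq_norm[OF q _ W']) measurable
  have intWq: "integrable M (\<lambda>\<omega>. W \<omega> powr q)"
    using integrable_powr_Lq_norm[OF _ _ _ W', of q] q W by simp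
  \<comment> \<open>Jensen's inequality needs an open interval, hence the shift of \<open>W\<close> into \<open>{0<..}\<close>.\<close>
  have V: "integrable M (\<lambda>\<omega>. (W \<omega> + 1) powr q)"
  proof (rule Bochner_Integration.integrable_bound[of M "\<lambda>\<omega>. 2 powr q * (W \<omega> powr q + 1)"])
    show "AE \<omega> in M. norm ((W \<omega> + 1) powr q) \<le> norm (2 powr q * (W \<omega> powr q + 1))"
    proof (rule AE_I2)
      fix \<omega>
      have "(W \<omega> + 1) powr q \<le> (2 * max (W \<omega>) 1) powr q"
        using W q by (intro powr_mono2) auto
      also have "\<dots> = 2 powr q * max (W \<omega>) 1 powr q" using W by (simp add: powr_mult)
      also have "\<dots> \<le> 2 powr q * (W \<omega> powr q + 1)"
        by (intro mult_left_mono) (auto simp: max_def)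
      finally show "norm ((W \<omega> + 1) powr q) \<le> norm (2 powr q * (W \<omega> powr q + 1))" by simp
    qed
  qed (use intWq in auto)
  have "AE \<omega> in M. (real_cond_exp M G (\<lambda>\<omega>. W \<omega> + 1) \<omega>) powr q
      \<le> real_cond_exp M G (\<lambda>\<omega>. (W \<omega> + 1) powr q) \<omega>"
    using W q intW V by (intro real_cond_exp_jensens_inequality(2)[where I = "{0<..}" and a = 0])
      (auto intro!: powr_convex add_nonneg_pos)
  moreover have "AE \<omega> in M. real_cond_exp M G (\<lambda>\<omega>. W \<omega> + 1) \<omega> = real_cond_exp M G W \<omega> + real_cond_exp M G (\<lambda>_. 1) \<omega>"
    using intW by (intro real_cond_exp_add) auto
  moreover have "AE \<omega> in M. real_cond_exp M G (\<lambda>_. 1) \<omega> = 1"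
    by (intro real_cond_exp_F_meas) auto
  moreover have "AE \<omega> in M. 0 \<le> real_cond_exp M G W \<omega>"
    using W by (intro real_cond_exp_pos) auto
  ultimately have "AE \<omega> in M. norm (\<bar>real_cond_exp M G W \<omega>\<bar> powr q) \<le> norm (real_cond_exp M G (\<lambda>\<omega>. (W \<omega> + 1) powr q) \<omega>)"
  proof eventually_elim
    case (elim \<omega>)
    have "\<bar>real_cond_exp M G W \<omega>\<bar> powr q \<le> (real_cond_exp M G W \<omega> + 1) powr q"
      using elim q by (intro powr_mono2) auto
    then show ?case using elim by simp
  qed
  then show ?thesis
    by (intro Bochner_Integration.integrable_bound[OF real_cond_exp_int(1)[OF V]]) auto
qed

text \<open>One step of a pathwise form of Doob's inequality: a new value \<open>y\<close> lifts the
  running maximum from \<open>s\<close> to \<open>max y s\<close>. Both sides vanish for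
  \<open>y \<le> s\<close>; otherwise Young's inequality bounds the mixed term
  \<open>y * s powr (q - 1)\<close>.\<close>

lemma Doob_powr_increment:
  fixes q s y :: real
  assumes q: "1 < q" and s: "0 \<le> s"
  shows "max y s powr q - s powr q \<le> q / (q - 1) * ((max y s powr (q - 1) - s powr (q - 1)) * y)"
proof (cases "y \<le> s")
  case True then show ?thesis by simp
next
  case False
  then have y: "0 < y" "max y s = y" using s by auto
  have "q / (q - 1) * (y * s powr (q - 1)) \<le> q / (q - 1) * (y powr q / q + (1 - 1 / q) * s powr q)"
    using q s y by (intro mult_left_mono Young_powr) auto
  also have "\<dots> = y powr q / (q - 1) + s powr q"
    using q by (simp add: field_simps)
  finally have "y powr q - s powr q \<le> (y powr q + y powr q / (q - 1)) - q / (q - 1) * (y * s powr (q - 1))"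
    by simp
  also have "y powr q + y powr q / (q - 1) = q / (q - 1) * (y powr (q - 1) * y)"
    using q y by (simp add: powr_diff field_simps)
  finally show ?thesis unfolding y(2) by (simp add: algebra_simps)
qed

text \<open>Let \<open>S\<close> be the running maximum and \<open>c = q / (q - 1)\<close>. Summing
  the pathwise increments gives that the expectation of \<open>S powr q\<close> is at most
  \<open>c\<close> times that of \<open>S powr (q - 1) * W\<close>; Young's inequality then
  separates \<open>S\<close> from \<open>W\<close>.\<close>

lemma (in prob_space) Doob_Lq_inequality:
  fixes F :: "'i::linorder \<Rightarrow> 'a measure"
  assumes q: "1 < q" and U: "finite U"
    and sub: "\<And>u. u \<in> U \<Longrightarrow> subalgebra M (F u)"
    and mono: "\<And>u v. u \<in> U \<Longrightarrow> v \<in> U \<Longrightarrow> u \<le> v \<Longrightarrow> sets (F u) \<subseteq> sets (F v)"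
    and W_meas [measurable]: "W \<in> borel_measurable M" and W: "\<And>\<omega>. 0 \<le> W \<omega>"
  shows "Lq_norm M q (\<lambda>\<omega>. SUP u\<in>U. ennreal (real_cond_exp M (F u) W \<omega>))
    \<le> ennreal (q / (q - 1)) * Lq_norm M q (\<lambda>\<omega>. ennreal (W \<omega>))"
proof (cases "Lq_norm M q (\<lambda>\<omega>. ennreal (W \<omega>))")
  case top
  then show ?thesis using q by (simp add: ennreal_mult_top)
next
  case (real w)
  then have fin: "Lq_norm M q (\<lambda>\<omega>. ennreal (W \<omega>)) < \<top>" by simp
  define c where "c = q / (q - 1)"
  have c: "0 < c" using q by (simp add: c_def)
  define Y where "Y = (\<lambda>u. real_cond_exp M (F u) W)"
  \<comment> \<open>Inserting 0 gives the empty set a maximum and keeps \<open>S\<close> nonnegative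
    even where a version of the conditional expectation is negative.\<close>
  define S where "S = (\<lambda>V \<omega>. Max (insert 0 ((\<lambda>u. Y u \<omega>) ` V)))"
  have S_insert: "S (insert b V) \<omega> = max (Y b \<omega>) (S V \<omega>)" if "finite V" for b V \<omega>
    using that by (simp add: S_def insert_commute[of 0])
  have S_empty: "S {} \<omega> = 0" for \<omega> by (simp add: S_def)
  have S_nonneg: "0 \<le> S V \<omega>" if "finite V" for V \<omega>
    using that by (simp add: S_def)
  have S_meas: "S V \<in> borel_measurable N" if "finite V" "\<And>u. u \<in> V \<Longrightarrow> Y u \<in> borel_measurable N" for V N
    using that
  proof (induction V)
    case empty then show ?case by (simp add: S_empty[abs_def])
  next
    case (insert b V)
    then have "S (insert b V) = (\<lambda>\<omega>. max (Y b \<omega>) (S V \<omega>))" by (auto simp: S_insert)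
    then show ?case using insert by simp
  qed
  have Y_meas [measurable]: "Y u \<in> borel_measurable M" for u by (simp add: Y_def)
  have S_measM: "S V \<in> borel_measurable M" if "finite V" for V using that by (intro S_meas) auto
  have intWq: "integrable M (\<lambda>\<omega>. W \<omega> powr q)"
    using integrable_powr_Lq_norm[of q q W] fin q W by simp
  have intSq: "integrable M (\<lambda>\<omega>. S V \<omega> powr q)" if "V \<subseteq> U" for V
    using finite_subset[OF that U] that
  proof (induction V)
    case empty then show ?case by (simp add: S_empty)
  next
    case (insert b V)
    have [measurable]: "S (insert b V) \<in> borel_measurable M" by (rule S_measM) (use insert in auto)
    have "integrable M (\<lambda>\<omega>. \<bar>Y b \<omega>\<bar> powr q + S V \<omega> powr q)"
      using insert integrable_powr_real_cond_exp[of "F b" q W] q fin W sub by (auto simp: Y_def)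
    then show ?case
    proof (rule Bochner_Integration.integrable_bound)
      show "AE \<omega> in M. norm (S (insert b V) \<omega> powr q) \<le> norm (\<bar>Y b \<omega>\<bar> powr q + S V \<omega> powr q)"
      proof (rule AE_I2)
        fix \<omega>
        have "max y z powr q \<le> \<bar>y\<bar> powr q + z powr q" if "0 \<le> z" for y z :: real
          using that by (cases "y \<le> z") auto
        from this[OF S_nonneg[OF insert(1)]]
        show "norm (S (insert b V) \<omega> powr q) \<le> norm (\<bar>Y b \<omega>\<bar> powr q + S V \<omega> powr q)"
          by (simp add: S_insert[OF insert(1)])
      qed
    qed measurable
  qed
  \<comment> \<open>Young's inequality dominates the product by the two integrable powers.\<close>
  have intWS: "integrable M (\<lambda>\<omega>. S V \<omega> powr (q - 1) * W \<omega>)" if "V \<subseteq> U" for V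
  proof (rule Bochner_Integration.integrable_bound)
    show "integrable M (\<lambda>\<omega>. W \<omega> powr q / q + (1 - 1 / q) * S V \<omega> powr q)"
      using intWq intSq[OF that] by auto
    have [measurable]: "S V \<in> borel_measurable M" by (rule S_measM) (use finite_subset[OF that U] in auto)
    show "(\<lambda>\<omega>. S V \<omega> powr (q - 1) * W \<omega>) \<in> borel_measurable M" by measurable
    show "AE \<omega> in M. norm (S V \<omega> powr (q - 1) * W \<omega>) \<le> norm (W \<omega> powr q / q + (1 - 1 / q) * S V \<omega> powr q)"
    proof (rule AE_I2)
      fix \<omega>
      show "norm (S V \<omega> powr (q - 1) * W \<omega>) \<le> norm (W \<omega> powr q / q + (1 - 1 / q) * S V \<omega> powr q)"
        using Young_powr[OF q W S_nonneg[OF finite_subset[OF that U]], of \<omega> \<omega>] W[of \<omega>] q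
        by (simp add: mult.commute)
    qed
  qed
  \<comment> \<open>Adding the times in increasing order makes the multiplier \<open>D\<close> below \<open>F b\<close>-measurable, so that \<open>Y\<close> may be replaced by \<open>W\<close>.\<close>
  have key: "(\<integral>\<omega>. S V \<omega> powr q \<partial>M) \<le> c * (\<integral>\<omega>. S V \<omega> powr (q - 1) * W \<omega> \<partial>M)" if "V \<subseteq> U" for V
    using finite_subset[OF that U] that
  proof (induction V rule: finite_linorder_max_induct)
    case empty then show ?case by (simp add: S_empty)
  next
    case (insert b V)
    then have b: "b \<in> U" "insert b V \<subseteq> U" "V \<subseteq> U" and V: "finite V" by auto
    interpret sigma_finite_subalgebra M "F b" by (rule sigma_finite_subalgebraI[OF sub[OF b(1)]])
    have YF: "Y u \<in> borel_measurable (F b)" if "u \<in> insert b V" for u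
    proof -
      have "u \<in> U" "u \<le> b" using that insert by auto
      then have "subalgebra (F b) (F u)"
        using sub[OF \<open>u \<in> U\<close>] subalg mono[OF \<open>u \<in> U\<close> b(1)] by (auto simp: subalgebra_def)
      then show ?thesis unfolding Y_def by (rule measurable_from_subalg) simp
    qed
    define D where "D = (\<lambda>\<omega>. S (insert b V) \<omega> powr (q - 1) - S V \<omega> powr (q - 1))"
    have [measurable]: "S V \<in> borel_measurable (F b)" "S (insert b V) \<in> borel_measurable (F b)"
      using V YF by (auto intro!: S_meas)
    have D_meas: "D \<in> borel_measurable (F b)" unfolding D_def by measurable
    have intDW: "integrable M (\<lambda>\<omega>. D \<omega> * W \<omega>)"
      unfolding D_def using intWS[OF b(2)] intWS[OF b(3)] by (simp add: left_diff_distrib)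
    have eq: "(\<integral>\<omega>. D \<omega> * Y b \<omega> \<partial>M) = (\<integral>\<omega>. D \<omega> * W \<omega> \<partial>M)"
      and intDY: "integrable M (\<lambda>\<omega>. D \<omega> * Y b \<omega>)"
      using real_cond_exp_intg[OF intDW D_meas] by (auto simp: Y_def)
    have "(\<integral>\<omega>. S (insert b V) \<omega> powr q \<partial>M) - (\<integral>\<omega>. S V \<omega> powr q \<partial>M)
        = (\<integral>\<omega>. S (insert b V) \<omega> powr q - S V \<omega> powr q \<partial>M)"
      using intSq b by simp
    also have "\<dots> \<le> (\<integral>\<omega>. c * (D \<omega> * Y b \<omega>) \<partial>M)"
    proof (rule integral_mono)
      show "S (insert b V) \<omega> powr q - S V \<omega> powr q \<le> c * (D \<omega> * Y b \<omega>)" for \<omega>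
        using Doob_powr_increment[OF q S_nonneg[OF V], of "Y b \<omega>" \<omega>] by (simp add: D_def S_insert[OF V] c_def)
    qed (use intSq[OF b(2)] intSq[OF b(3)] intDY in auto)
    also have "\<dots> = c * (\<integral>\<omega>. D \<omega> * W \<omega> \<partial>M)" using eq by simp
    also have "(\<integral>\<omega>. D \<omega> * W \<omega> \<partial>M)
        = (\<integral>\<omega>. S (insert b V) \<omega> powr (q - 1) * W \<omega> \<partial>M) - (\<integral>\<omega>. S V \<omega> powr (q - 1) * W \<omega> \<partial>M)"
      unfolding D_def using intWS[OF b(2)] intWS[OF b(3)] by (simp add: left_diff_distrib)
    finally show ?case using insert.IH[OF b(3)] by (simp add: algebra_simps)
  qed
  have "(\<integral>\<omega>. S U \<omega> powr q \<partial>M) \<le> (\<integral>\<omega>. c * (S U \<omega> powr (q - 1) * W \<omega>) \<partial>M)"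
    using key[of U] by simp
  \<comment> \<open>Young's inequality with \<open>c * W\<close> as first factor. Absorbing the
    share \<open>1 - 1 / q\<close> leaves the factor \<open>1 / q\<close> on both sides, so that the
    constant is exactly \<open>c\<close>.\<close>
  also have "\<dots> \<le> (\<integral>\<omega>. (c powr q / q) * W \<omega> powr q + (1 - 1 / q) * S U \<omega> powr q \<partial>M)"
  proof (rule integral_mono)
    fix \<omega>
    show "c * (S U \<omega> powr (q - 1) * W \<omega>) \<le> (c powr q / q) * W \<omega> powr q + (1 - 1 / q) * S U \<omega> powr q"
      using Young_powr[OF q _ S_nonneg[OF U], of "c * W \<omega>" \<omega>] W[of \<omega>] c
      by (simp add: powr_mult mult_ac)
  qed (use intWS[of U] intWq intSq[of U] in auto)
  also have "\<dots> = (c powr q / q) * (\<integral>\<omega>. W \<omega> powr q \<partial>M) + (1 - 1 / q) * (\<integral>\<omega>. S U \<omega> powr q \<partial>M)"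
    using intWq intSq[of U] by simp
  finally have "(\<integral>\<omega>. S U \<omega> powr q \<partial>M) / q \<le> (c powr q * (\<integral>\<omega>. W \<omega> powr q \<partial>M)) / q"
    by (simp add: algebra_simps)
  then have le: "(\<integral>\<omega>. S U \<omega> powr q \<partial>M) \<le> c powr q * (\<integral>\<omega>. W \<omega> powr q \<partial>M)"
    using q by (simp add: divide_le_cancel)
  have "ennreal (w powr q) = (\<integral>\<^sup>+\<omega>. ennreal (W \<omega> powr q) \<partial>M)"
    using ennreal_powr_Lq_norm[of q M "\<lambda>\<omega>. ennreal (W \<omega>)"] real q W by simp
  also have "\<dots> = ennreal (\<integral>\<omega>. W \<omega> powr q \<partial>M)"
    by (intro nn_integral_eq_integral intWq) auto
  finally have w: "w powr q = (\<integral>\<omega>. W \<omega> powr q \<partial>M)" by simp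
  have "(\<integral>\<^sup>+\<omega>. ennreal (S U \<omega> powr q) \<partial>M) = ennreal (\<integral>\<omega>. S U \<omega> powr q \<partial>M)"
    by (intro nn_integral_eq_integral intSq) auto
  also have "\<dots> \<le> ennreal ((c * w) powr q)"
    using le w c real by (intro ennreal_leI) (simp add: powr_mult)
  finally have "Lq_norm M q (\<lambda>\<omega>. ennreal (S U \<omega>)) \<le> ennreal (c * w)"
    using q c real S_nonneg[OF U] by (subst Lq_norm_le_iff) auto
  moreover have "Lq_norm M q (\<lambda>\<omega>. SUP u\<in>U. ennreal (Y u \<omega>)) \<le> Lq_norm M q (\<lambda>\<omega>. ennreal (S U \<omega>))"
    using q U by (intro Lq_norm_mono_AE AE_I2 SUP_least ennreal_leI) (auto simp: S_def)
  ultimately have "Lq_norm M q (\<lambda>\<omega>. SUP u\<in>U. ennreal (Y u \<omega>)) \<le> ennreal (c * w)" by simp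
  then show ?thesis using c real by (simp add: Y_def ennreal_mult flip: c_def)
qed

section \<open>Dyadic chaining\<close>

lemma (in prob_space) abs_real_cond_exp_le:
  assumes "subalgebra M G" and f: "integrable M f"
  shows "AE \<omega> in M. \<bar>real_cond_exp M G f \<omega>\<bar> \<le> real_cond_exp M G (\<lambda>\<omega>. \<bar>f \<omega>\<bar>) \<omega>"
proof -
  interpret sigma_finite_subalgebra M G by (rule sigma_finite_subalgebraI[OF assms(1)])
  have "AE \<omega> in M. real_cond_exp M G f \<omega> \<le> real_cond_exp M G (\<lambda>\<omega>. \<bar>f \<omega>\<bar>) \<omega>"
    using f by (intro real_cond_exp_mono) auto
  moreover have "AE \<omega> in M. real_cond_exp M G (\<lambda>\<omega>. -1 * f \<omega>) \<omega> \<le> real_cond_exp M G (\<lambda>\<omega>. \<bar>f \<omega>\<bar>) \<omega>"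
    using f by (intro real_cond_exp_mono) auto
  moreover have "AE \<omega> in M. real_cond_exp M G (\<lambda>\<omega>. -1 * f \<omega>) \<omega> = -1 * real_cond_exp M G f \<omega>"
    by (rule real_cond_exp_cmult[OF f])
  ultimately show ?thesis by eventually_elim linarith
qed

text \<open>One link of the chain, seen from the smaller sigma-algebra \<open>H\<close>. By the
  tower property the conditional expectation of \<open>g\<close> is that of \<open>f\<close> minus
  that of the defect \<open>real_cond_exp M G f - g\<close>, and \<open>R\<close> dominates the
  defect.\<close>

lemma (in prob_space) abs_real_cond_exp_le_step:
  assumes G: "subalgebra M G" and H: "subalgebra M H" "sets H \<subseteq> sets G"
    and int: "integrable M f" "integrable M g" "integrable M W" "integrable M R"
    and R: "AE \<omega> in M. \<bar>real_cond_exp M G f \<omega> - g \<omega>\<bar> \<le> R \<omega>"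
    and f: "AE \<omega> in M. \<bar>real_cond_exp M H f \<omega>\<bar> \<le> real_cond_exp M H W \<omega>"
  shows "AE \<omega> in M. \<bar>real_cond_exp M H g \<omega>\<bar> \<le> real_cond_exp M H (\<lambda>\<omega>. W \<omega> + R \<omega>) \<omega>"
proof -
  interpret G: sigma_finite_subalgebra M G by (rule sigma_finite_subalgebraI[OF G])
  interpret H: sigma_finite_subalgebra M H by (rule sigma_finite_subalgebraI[OF H(1)])
  have GH: "subalgebra G H" using G H by (auto simp: subalgebra_def)
  let ?d = "\<lambda>\<omega>. real_cond_exp M G f \<omega> - g \<omega>"
  have intd: "integrable M ?d" using int G.real_cond_exp_int(1) by auto
  have "AE \<omega> in M. real_cond_exp M H ?d \<omega> = real_cond_exp M H (real_cond_exp M G f) \<omega> - real_cond_exp M H g \<omega>"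
    using int G.real_cond_exp_int(1) by (intro H.real_cond_exp_diff) auto
  moreover have "AE \<omega> in M. real_cond_exp M H (real_cond_exp M G f) \<omega> = real_cond_exp M H f \<omega>"
    by (intro H.real_cond_exp_nested_subalg G GH int)
  moreover have "AE \<omega> in M. \<bar>real_cond_exp M H ?d \<omega>\<bar> \<le> real_cond_exp M H (\<lambda>\<omega>. \<bar>?d \<omega>\<bar>) \<omega>"
    by (rule abs_real_cond_exp_le[OF H(1) intd])
  moreover have "AE \<omega> in M. real_cond_exp M H (\<lambda>\<omega>. \<bar>?d \<omega>\<bar>) \<omega> \<le> real_cond_exp M H R \<omega>"
    using R int intd by (intro H.real_cond_exp_mono) auto
  moreover have "AE \<omega> in M. real_cond_exp M H (\<lambda>\<omega>. W \<omega> + R \<omega>) \<omega> = real_cond_exp M H W \<omega> + real_cond_exp M H R \<omega>"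
    using int by (intro H.real_cond_exp_add) auto
  ultimately show ?thesis using f by eventually_elim linarith
qed

lemma dyadic_point_mem:
  fixes s t :: real
  assumes "s \<le> t" "i \<le> 2 ^ k"
  shows "s + (t - s) * real i / 2 ^ k \<in> {s..t}"
proof -
  have "real i \<le> real (2 ^ k)" using assms(2) by (simp only: of_nat_le_iff)
  then have "(t - s) * (real i / 2 ^ k) \<le> (t - s) * 1"
    using assms(1) by (intro mult_left_mono) auto
  then show ?thesis using assms(1) by simp
qed

text \<open>Induction on the level \<open>n\<close> with \<open>r\<close> fixed. An even point of
  level \<open>n + 1\<close> already lies on level \<open>n\<close>; an odd one is linked to its
  right neighbour, which lies on level \<open>n\<close>, at the cost of \<open>R (n + 1)\<close>.
  Every level is thus used at most once, and the chain moves right until it reaches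
  \<open>t\<close>.\<close>

lemma (in prob_space) dyadic_chaining:
  fixes s t :: real and g :: "nat \<Rightarrow> nat \<Rightarrow> real"
  defines "g \<equiv> \<lambda>k i. s + (t - s) * real i / 2 ^ k"
  assumes st: "s < t"
    and sub: "\<And>u. u \<in> {s..t} \<Longrightarrow> subalgebra M (F u)"
    and mono: "\<And>u v. s \<le> u \<Longrightarrow> u \<le> v \<Longrightarrow> v \<le> t \<Longrightarrow> sets (F u) \<subseteq> sets (F v)"
    and X: "\<And>u. u \<in> {s..t} \<Longrightarrow> integrable M (X u)"
    and R: "\<And>k. integrable M (R k)" "\<And>k \<omega>. 0 \<le> R k \<omega>"
    and XR: "\<And>k i. i < 2 ^ k \<Longrightarrow>
      AE \<omega> in M. \<bar>real_cond_exp M (F (g k i)) (X (g k (Suc i))) \<omega> - X (g k i) \<omega>\<bar> \<le> R k \<omega>"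
    and i: "i \<le> 2 ^ n" and r: "s \<le> r" "r \<le> g n i"
  shows "AE \<omega> in M. \<bar>real_cond_exp M (F r) (X (g n i)) \<omega>\<bar>
    \<le> real_cond_exp M (F r) (\<lambda>\<omega>. \<bar>X t \<omega>\<bar> + (\<Sum>k\<le>n. R k \<omega>)) \<omega>"
proof -
  have g: "g k i \<in> {s..t}" if "i \<le> 2 ^ k" for k i
    unfolding g_def using st that by (intro dyadic_point_mem) auto
  have r': "r \<in> {s..t}" if "i \<le> 2 ^ k" "r \<le> g k i" for i k using g[OF that(1)] that r by auto
  have Xt: "AE \<omega> in M. \<bar>real_cond_exp M (F r) (X t) \<omega>\<bar> \<le> real_cond_exp M (F r) (\<lambda>\<omega>. \<bar>X t \<omega>\<bar>) \<omega>" if "r \<in> {s..t}"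
    using that X st by (intro abs_real_cond_exp_le sub) auto
  \<comment> \<open>For points that need no link on level \<open>k\<close>: adding the nonnegative
    \<open>R k\<close> gives them the same bound as the linked ones.\<close>
  have weaken: "AE \<omega> in M. real_cond_exp M (F r) V \<omega> \<le> real_cond_exp M (F r) (\<lambda>\<omega>. V \<omega> + R k \<omega>) \<omega>"
    if "r \<in> {s..t}" "integrable M V" for V k
  proof -
    interpret sigma_finite_subalgebra M "F r" by (rule sigma_finite_subalgebraI[OF sub[OF that(1)]])
    show ?thesis using that R by (intro real_cond_exp_mono) auto
  qed
  have step: "AE \<omega> in M. \<bar>real_cond_exp M (F r) (X (g k i)) \<omega>\<bar> \<le> real_cond_exp M (F r) (\<lambda>\<omega>. V \<omega> + R k \<omega>) \<omega>"
    if "i < 2 ^ k" "r \<le> g k i" "integrable M V"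
      and "AE \<omega> in M. \<bar>real_cond_exp M (F r) (X (g k (Suc i))) \<omega>\<bar> \<le> real_cond_exp M (F r) V \<omega>" for i k V
  proof (rule abs_real_cond_exp_le_step[OF _ _ _ _ _ that(3) R(1) XR[OF that(1)] that(4)])
    have "g k i \<in> {s..t}" "g k (Suc i) \<in> {s..t}" using g[of i k] g[of "Suc i" k] that(1) by auto
    then show "subalgebra M (F (g k i))" "subalgebra M (F r)" "sets (F r) \<subseteq> sets (F (g k i))"
        "integrable M (X (g k i))" "integrable M (X (g k (Suc i)))"
      using r(1) that(2) mono[of r "g k i"] by (auto intro!: sub X)
  qed
  show ?thesis using i r(2)
  proof (induction n arbitrary: i)
    case 0
    have g01: "g 0 (Suc 0) = t" by (simp add: g_def)
    have "r \<in> {s..t}" using r'[OF 0] .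
    have intX: "integrable M (\<lambda>\<omega>. \<bar>X t \<omega>\<bar>)" using X st by simp
    have "i = 0 \<or> i = 1" using 0 by auto
    then show ?case
    proof
      assume "i = 0"
      then show ?thesis using step[of 0 0 "\<lambda>\<omega>. \<bar>X t \<omega>\<bar>"] 0 intX Xt[OF \<open>r \<in> {s..t}\<close>] by (simp add: g01)
    next
      assume "i = 1"
      then show ?thesis using weaken[OF \<open>r \<in> {s..t}\<close> intX, of 0] Xt[OF \<open>r \<in> {s..t}\<close>] by (auto simp: g01)
    qed
  next
    case (Suc n)
    have rst: "r \<in> {s..t}" using r'[OF Suc.prems] .
    let ?W = "\<lambda>\<omega>. \<bar>X t \<omega>\<bar> + (\<Sum>k\<le>n. R k \<omega>)"
    have intW: "integrable M ?W" using X st R by auto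
    have gg: "g (Suc n) (2 * j) = g n j" for j by (simp add: g_def field_simps)
    have "AE \<omega> in M. \<bar>real_cond_exp M (F r) (X (g (Suc n) i)) \<omega>\<bar> \<le> real_cond_exp M (F r) (\<lambda>\<omega>. ?W \<omega> + R (Suc n) \<omega>) \<omega>"
    proof (cases "even i")
      case True
      then obtain j where j: "i = 2 * j" by auto
      then have "AE \<omega> in M. \<bar>real_cond_exp M (F r) (X (g (Suc n) i)) \<omega>\<bar> \<le> real_cond_exp M (F r) ?W \<omega>"
        using Suc.IH[of j] Suc.prems by (simp add: gg)
      then show ?thesis using weaken[OF rst intW, of "Suc n"] by eventually_elim linarith
    next
      case False
      then obtain j where j: "i = 2 * j + 1" by (rule oddE)
      then have Sj: "Suc i = 2 * Suc j" by simp
      \<comment> \<open>An odd index differs from \<open>2 ^ Suc n\<close>, so the point has a right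
        neighbour on the grid.\<close>
      have i: "i < 2 ^ Suc n" using Suc.prems(1) False by (metis even_power even_numeral le_neq_implies_less zero_less_Suc)
      have eq: "g (Suc n) (Suc i) = g n (Suc j)" by (simp only: Sj gg)
      have "g (Suc n) i \<le> g (Suc n) (Suc i)"
        using st by (auto simp: g_def intro!: divide_right_mono mult_left_mono)
      then have "AE \<omega> in M. \<bar>real_cond_exp M (F r) (X (g (Suc n) (Suc i))) \<omega>\<bar> \<le> real_cond_exp M (F r) ?W \<omega>"
        unfolding eq using Suc.IH[of "Suc j"] Suc.prems(2) i j by simp
      then show ?thesis by (intro step i intW Suc.prems(2))
    qed
    then show ?case by (simp add: add.assoc)
  qed
qed

lemma abs_le_sum_powr:
  fixes x :: "'i \<Rightarrow> real"
  assumes "0 < p" "finite I" "i \<in> I"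
  shows "\<bar>x i\<bar> \<le> (\<Sum>i\<in>I. \<bar>x i\<bar> powr p) powr (1 / p)"
proof -
  have "\<bar>x i\<bar> = (\<bar>x i\<bar> powr p) powr (1 / p)" using assms by (simp add: powr_powr)
  also have "\<dots> \<le> (\<Sum>i\<in>I. \<bar>x i\<bar> powr p) powr (1 / p)"
    using assms by (intro powr_mono2 member_le_sum) auto
  finally show ?thesis .
qed

text \<open>\<open>\<rho>\<close> is the ratio of the bounds for consecutive levels and is below 1
  because \<open>p * h > 1\<close>. In the final factor, \<open>1 / (1 - \<rho>)\<close> sums the
  levels of the grid and the additional 1 pays for linking \<open>U\<close> to the grid. The bound
  is uniform in \<open>U\<close>, which permits the passage to countable sets.\<close>

lemma (in prob_space) Lq_norm_finite_sup:
  fixes s t p h A :: real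
  defines "B \<equiv> A powr (1 / p) * (t - s) powr h" and "\<rho> \<equiv> 2 powr (- (p * h - 1) / p)"
  assumes p: "1 < p" and h: "0 < h" and ph: "1 < p * h" and A: "0 \<le> A" and st: "s < t"
    and sub: "\<And>u. u \<in> {s..t} \<Longrightarrow> subalgebra M (F u)"
    and mono: "\<And>u v. s \<le> u \<Longrightarrow> u \<le> v \<Longrightarrow> v \<le> t \<Longrightarrow> sets (F u) \<subseteq> sets (F v)"
    and X: "\<And>u. u \<in> {s..t} \<Longrightarrow> integrable M (X u)"
    and Xt: "X t \<in> borel_measurable (F t)"
    and D: "\<And>u v. s \<le> u \<Longrightarrow> u < v \<Longrightarrow> v \<le> t \<Longrightarrow>
      (\<integral>\<^sup>+ \<omega>. ennreal (\<bar>real_cond_exp M (F u) (X v) \<omega> - X u \<omega>\<bar> powr p) \<partial>M)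
        \<le> ennreal (A * (v - u) powr (p * h))"
    and q: "1 < q" "q \<le> p"
    and U: "finite U" "U \<subseteq> {s..t}"
  shows "Lq_norm M q (\<lambda>\<omega>. SUP u\<in>U. ennreal \<bar>X u \<omega>\<bar>)
    \<le> ennreal (q / (q - 1)) * (ennreal (B * (1 / (1 - \<rho>) + 1)) + Lq_norm M q (\<lambda>\<omega>. ennreal \<bar>X t \<omega>\<bar>))"
proof -
  define g where "g = (\<lambda>(k::nat) (i::nat). s + (t - s) * real i / 2 ^ k)"
  have g: "g k i \<in> {s..t}" if "i \<le> 2 ^ k" for k i
    unfolding g_def using st that by (intro dyadic_point_mem) auto
  have g_less: "g k i < g k (Suc i)" for k i
    using st by (simp add: g_def divide_strict_right_mono)
  have g_diff: "g k (Suc i) - g k i = (t - s) / 2 ^ k" for k i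
    by (simp add: g_def algebra_simps add_divide_distrib diff_divide_distrib)
  have X_meas [measurable]: "X u \<in> borel_measurable M" if "u \<in> {s..t}" for u using X[OF that] by simp
  have Xt_meas [measurable]: "X t \<in> borel_measurable M" using st by (intro X_meas) auto
  have "2 powr (- (p * h - 1) / p) < 2 powr (0 :: real)"
    using p ph by (intro powr_less_mono) (auto simp: divide_neg_pos)
  then have \<rho>: "0 < \<rho>" "\<rho> < 1" by (simp_all add: \<rho>_def)
  have B: "0 \<le> B" using A st by (simp add: B_def)
  \<comment> \<open>Level \<open>k\<close> has \<open>2 ^ k\<close> increments over intervals of
    length \<open>(t - s) / 2 ^ k\<close>. The powers of 2 combine to the exponent
    \<open>k * (1 - p * h)\<close>, whose root is \<open>\<rho> ^ k\<close>.\<close>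
  have scale: "(2 ^ k * (A * ((t - s) / 2 ^ k) powr (p * h))) powr (1 / p) = B * \<rho> ^ k" for k
  proof -
    have 1: "2 ^ k * (A * ((t - s) / 2 ^ k) powr (p * h)) = A * (t - s) powr (p * h) * 2 powr (real k * (1 - p * h))"
      using st by (simp add: powr_divide powr_diff powr_powr mult_ac right_diff_distrib flip: powr_realpow)
    have 2: "(2 powr (real k * (1 - p * h))) powr (1 / p) = \<rho> ^ k"
    proof -
      have "\<rho> ^ k = \<rho> powr real k" using \<rho> by (simp add: powr_realpow)
      also have "\<dots> = 2 powr (- (p * h - 1) / p * real k)" by (simp only: \<rho>_def powr_powr)
      also have "- (p * h - 1) / p * real k = real k * (1 - p * h) * (1 / p)" using p by (simp add: field_simps)
      finally show ?thesis by (simp only: powr_powr)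
    qed
    have 3: "(A * (t - s) powr (p * h)) powr (1 / p) = B"
      using A st p by (simp add: powr_mult powr_powr B_def)
    show ?thesis unfolding 1 using A st by (subst powr_mult) (auto simp only: 2 3)
  qed
  define R where "R = (\<lambda>k \<omega>. (\<Sum>i<2 ^ k. \<bar>real_cond_exp M (F (g k i)) (X (g k (Suc i))) \<omega> - X (g k i) \<omega>\<bar> powr p) powr (1 / p))"
  have R_nonneg: "0 \<le> R k \<omega>" for k \<omega> by (simp add: R_def)
  have R_meas [measurable]: "R k \<in> borel_measurable M" for k
  proof -
    have [measurable]: "X (g k i) \<in> borel_measurable M" if "i \<in> {..<2 ^ k}" for i
      using that by (intro X_meas g) auto
    show ?thesis unfolding R_def by measurable
  qed
  have R_norm: "Lq_norm M p (\<lambda>\<omega>. ennreal (R k \<omega>)) \<le> ennreal (B * \<rho> ^ k)" for k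
  proof -
    have "Lq_norm M p (\<lambda>\<omega>. ennreal (R k \<omega>))
        \<le> ennreal ((card {..<2 ^ k :: nat} * (A * ((t - s) / 2 ^ k) powr (p * h))) powr (1 / p))"
      unfolding R_def
    proof (rule Lq_norm_sum_powr_le)
      fix i :: nat assume "i \<in> {..<2 ^ k}"
      then have i: "g k i \<in> {s..t}" "g k (Suc i) \<in> {s..t}" using g[of i k] g[of "Suc i" k] by auto
      then show "(\<lambda>\<omega>. real_cond_exp M (F (g k i)) (X (g k (Suc i))) \<omega> - X (g k i) \<omega>) \<in> borel_measurable M"
        by measurable
      show "(\<integral>\<^sup>+ \<omega>. ennreal (\<bar>real_cond_exp M (F (g k i)) (X (g k (Suc i))) \<omega> - X (g k i) \<omega>\<bar> powr p) \<partial>M)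
          \<le> ennreal (A * ((t - s) / 2 ^ k) powr (p * h))"
        using D[of "g k i" "g k (Suc i)"] i g_less g_diff by simp
    qed (use p A in auto)
    then show ?thesis using scale[of k] by simp
  qed
  have R_int: "integrable M (R k)" for k
    using R_norm[of k] p R_nonneg by (intro integrable_Lq_norm[of p]) (auto intro: order_le_less_trans)

  \<comment> \<open>The level is chosen so fine that the links starting in \<open>U\<close> are
    fewer than its increments; each link is also no longer than its mesh.\<close>
  obtain n where "card U < 2 ^ n" using less_exp by blast
  \<comment> \<open>The index of the first grid point of level \<open>n\<close> strictly to the
    right of \<open>u\<close>. The added 1 ensures strictness, which the moment hypothesis
    requires.\<close>
  define v where "v = (\<lambda>u. nat \<lfloor>(u - s) / (t - s) * 2 ^ n\<rfloor> + 1)"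
  have v: "v u \<le> 2 ^ n" "u < g n (v u)" "g n (v u) - u \<le> (t - s) / 2 ^ n" if "s \<le> u" "u < t" for u
  proof -
    let ?x = "(u - s) / (t - s) * 2 ^ n"
    have x: "0 \<le> ?x" "?x < 2 ^ n" using that st by (auto simp: field_simps)
    have "\<lfloor>?x\<rfloor> < 2 ^ n" using x(2) by (simp add: floor_less_iff)
    then have "nat \<lfloor>?x\<rfloor> < 2 ^ n" using x(1) by (subst nat_less_iff) auto
    then show "v u \<le> 2 ^ n" unfolding v_def by linarith
    have vx: "?x < real (v u)" "real (v u) \<le> ?x + 1" using x(1) by (simp_all add: v_def) linarith+
    have gx: "g n (v u) = u + (t - s) / 2 ^ n * (real (v u) - ?x)"
      using st by (simp add: g_def field_simps)
    show "u < g n (v u)" unfolding gx using vx st by simp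
    have "(t - s) / 2 ^ n * (real (v u) - ?x) \<le> (t - s) / 2 ^ n * 1"
      using vx st by (intro mult_left_mono) auto
    then show "g n (v u) - u \<le> (t - s) / 2 ^ n" unfolding gx by simp
  qed
  \<comment> \<open>The link from \<open>u\<close> to the grid. It is set to 0 at
    \<open>u = t\<close>, which has no grid point to its right.\<close>
  define E where "E = (\<lambda>u \<omega>. if u < t then real_cond_exp M (F u) (X (g n (v u))) \<omega> - X u \<omega> else 0)"
  define Q where "Q = (\<lambda>\<omega>. (\<Sum>u\<in>U. \<bar>E u \<omega>\<bar> powr p) powr (1 / p))"
  have E_meas [measurable]: "E u \<in> borel_measurable M" if "u \<in> U" for u
  proof -
    have "X u \<in> borel_measurable M" using that U by auto
    then show ?thesis unfolding E_def by (cases "u < t") simp_all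
  qed
  have Q_meas [measurable]: "Q \<in> borel_measurable M" unfolding Q_def by measurable
  have "Lq_norm M p (\<lambda>\<omega>. ennreal (Q \<omega>)) \<le> ennreal ((card U * (A * ((t - s) / 2 ^ n) powr (p * h))) powr (1 / p))"
    unfolding Q_def
  proof (rule Lq_norm_sum_powr_le)
    fix u assume "u \<in> U"
    then have u: "s \<le> u" "u \<le> t" using U by auto
    show "(\<integral>\<^sup>+ \<omega>. ennreal (\<bar>E u \<omega>\<bar> powr p) \<partial>M) \<le> ennreal (A * ((t - s) / 2 ^ n) powr (p * h))"
    proof (cases "u < t")
      case True
      have "(\<integral>\<^sup>+ \<omega>. ennreal (\<bar>E u \<omega>\<bar> powr p) \<partial>M) \<le> ennreal (A * (g n (v u) - u) powr (p * h))"
        using D[of u "g n (v u)"] v[of u] g[of "v u" n] True u by (simp add: E_def)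
      also have "\<dots> \<le> ennreal (A * ((t - s) / 2 ^ n) powr (p * h))"
        using v[of u] True u A ph by (intro ennreal_leI mult_left_mono powr_mono2) auto
      finally show ?thesis .
    next
      case False then show ?thesis by (simp add: E_def)
    qed
  qed (use p A in auto)
  also have "\<dots> \<le> ennreal ((2 ^ n * (A * ((t - s) / 2 ^ n) powr (p * h))) powr (1 / p))"
  proof (intro ennreal_leI powr_mono2 mult_right_mono)
    show "real (card U) \<le> 2 ^ n"
      using \<open>card U < 2 ^ n\<close> by (metis less_imp_le of_nat_le_iff of_nat_numeral of_nat_power)
  qed (use p A in auto)
  also have "\<dots> \<le> ennreal B"
    unfolding scale using B \<rho> by (intro ennreal_leI mult_left_le) (auto simp: power_le_one)
  finally have Q_norm: "Lq_norm M q (\<lambda>\<omega>. ennreal (Q \<omega>)) \<le> ennreal B"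
    using q by (intro order_trans[OF Lq_norm_mono_exponent[of q p]]) auto

  define W where "W = (\<lambda>\<omega>. \<bar>X t \<omega>\<bar> + (\<Sum>k\<le>n. R k \<omega>))"
  have W_meas [measurable]: "W \<in> borel_measurable M" unfolding W_def by measurable
  have W_nonneg: "0 \<le> W \<omega>" for \<omega> by (simp add: W_def R_nonneg sum_nonneg)
  have W_int: "integrable M W" using R_int X[of t] st by (auto simp: W_def)
  \<comment> \<open>For \<open>u < t\<close>, \<open>X u\<close> is the conditional expectation of
    \<open>X (g n (v u))\<close> minus \<open>E u\<close>; chaining bounds the former and
    \<open>Q\<close> the latter. At \<open>u = t\<close> the measurability of \<open>X t\<close>
    makes \<open>\<bar>X t\<bar>\<close> its own conditional expectation.\<close>
  have bound: "AE \<omega> in M. \<bar>X u \<omega>\<bar> \<le> real_cond_exp M (F u) W \<omega> + Q \<omega>" if u: "u \<in> U" for u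
  proof (cases "u < t")
    case True
    have su: "s \<le> u" using u U by auto
    have "AE \<omega> in M. \<bar>real_cond_exp M (F u) (X (g n (v u))) \<omega>\<bar> \<le> real_cond_exp M (F u) W \<omega>"
      unfolding W_def g_def
    proof (rule dyadic_chaining[OF st sub mono X R_int R_nonneg])
      fix k i :: nat assume "i < 2 ^ k"
      then have "AE \<omega> in M. \<bar>real_cond_exp M (F (g k i)) (X (g k (Suc i))) \<omega> - X (g k i) \<omega>\<bar> \<le> R k \<omega>"
        using p abs_le_sum_powr[where p = p and I = "{..<2 ^ k}" and i = i and
            x = "\<lambda>i. real_cond_exp M (F (g k i)) (X (g k (Suc i))) _ - X (g k i) _"]
        unfolding R_def by (intro AE_I2) auto
      then show "AE \<omega> in M. \<bar>real_cond_exp M (F (s + (t - s) * real i / 2 ^ k)) (X (s + (t - s) * real (Suc i) / 2 ^ k)) \<omega>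
          - X (s + (t - s) * real i / 2 ^ k) \<omega>\<bar> \<le> R k \<omega>"
        unfolding g_def .
    qed (use v[OF su True] su in \<open>auto simp: g_def\<close>)
    moreover have "\<bar>E u \<omega>\<bar> \<le> Q \<omega>" for \<omega>
      unfolding Q_def using p U u by (intro abs_le_sum_powr) auto
    ultimately show ?thesis
      using True by (auto elim!: eventually_mono simp: E_def) (smt (verit))
  next
    case False
    then have [simp]: "u = t" using u U by auto
    have subt: "subalgebra M (F t)" using st by (intro sub) auto
    interpret sigma_finite_subalgebra M "F t" by (rule sigma_finite_subalgebraI[OF subt])
    have int: "integrable M (\<lambda>\<omega>. \<bar>X t \<omega>\<bar>)" using X[of t] st by auto
    have "AE \<omega> in M. real_cond_exp M (F t) (\<lambda>\<omega>. \<bar>X t \<omega>\<bar>) \<omega> = \<bar>X t \<omega>\<bar>"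
      by (intro real_cond_exp_F_meas int borel_measurable_abs Xt)
    moreover have "AE \<omega> in M. real_cond_exp M (F t) (\<lambda>\<omega>. \<bar>X t \<omega>\<bar>) \<omega> \<le> real_cond_exp M (F t) W \<omega>"
      using W_int int by (intro real_cond_exp_mono) (auto simp: W_def R_nonneg sum_nonneg)
    moreover have "AE \<omega> in M. 0 \<le> Q \<omega>" by (simp add: Q_def)
    ultimately show ?thesis by eventually_elim (simp only: \<open>u = t\<close>)
  qed
  let ?S = "\<lambda>\<omega>. SUP u\<in>U. ennreal (real_cond_exp M (F u) W \<omega>)"
  have S_meas [measurable]: "?S \<in> borel_measurable M"
    using U(1) by (intro borel_measurable_SUP countable_finite) auto
  have "AE \<omega> in M. \<forall>u\<in>U. \<bar>X u \<omega>\<bar> \<le> real_cond_exp M (F u) W \<omega> + Q \<omega>"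
    using bound by (intro AE_finite_allI U(1))
  then have "AE \<omega> in M. (SUP u\<in>U. ennreal \<bar>X u \<omega>\<bar>) \<le> ?S \<omega> + ennreal (Q \<omega>)"
  proof eventually_elim
    case (elim \<omega>)
    show ?case
    proof (rule SUP_least)
      fix u assume u: "u \<in> U"
      have "ennreal \<bar>X u \<omega>\<bar> \<le> ennreal (real_cond_exp M (F u) W \<omega> + Q \<omega>)"
        using elim u by (intro ennreal_leI) auto
      \<comment> \<open>\<open>ennreal\<close> is additive only on nonnegative numbers, and a
        version of the conditional expectation may be negative on a null set.\<close>
      also have "\<dots> \<le> ennreal (max 0 (real_cond_exp M (F u) W \<omega>) + Q \<omega>)"
        by (intro ennreal_leI) auto
      also have "\<dots> = ennreal (real_cond_exp M (F u) W \<omega>) + ennreal (Q \<omega>)"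
        by (simp add: Q_def ennreal_max_0)
      also have "\<dots> \<le> ?S \<omega> + ennreal (Q \<omega>)"
        using u by (intro add_right_mono SUP_upper)
      finally show "ennreal \<bar>X u \<omega>\<bar> \<le> ?S \<omega> + ennreal (Q \<omega>)" .
    qed
  qed
  then have "Lq_norm M q (\<lambda>\<omega>. SUP u\<in>U. ennreal \<bar>X u \<omega>\<bar>) \<le> Lq_norm M q (\<lambda>\<omega>. ?S \<omega> + ennreal (Q \<omega>))"
    using q by (intro Lq_norm_mono_AE) auto
  also have "\<dots> \<le> Lq_norm M q ?S + Lq_norm M q (\<lambda>\<omega>. ennreal (Q \<omega>))"
    using q by (intro Lq_norm_triangle) auto
  also have "\<dots> \<le> ennreal (q / (q - 1)) * Lq_norm M q (\<lambda>\<omega>. ennreal (W \<omega>)) + ennreal (q / (q - 1)) * ennreal B"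
  proof (rule add_mono)
    show "Lq_norm M q ?S \<le> ennreal (q / (q - 1)) * Lq_norm M q (\<lambda>\<omega>. ennreal (W \<omega>))"
      using U q by (intro Doob_Lq_inequality W_nonneg sub mono) auto
    \<comment> \<open>Since \<open>q / (q - 1) \<ge> 1\<close>, the norm of \<open>Q\<close> fits
      under the factor from Doob's inequality.\<close>
    have "1 * ennreal B \<le> ennreal (q / (q - 1)) * ennreal B"
      using q by (intro mult_right_mono) auto
    then show "Lq_norm M q (\<lambda>\<omega>. ennreal (Q \<omega>)) \<le> ennreal (q / (q - 1)) * ennreal B"
      using Q_norm by simp
  qed
  also have "Lq_norm M q (\<lambda>\<omega>. ennreal (W \<omega>)) \<le> Lq_norm M q (\<lambda>\<omega>. ennreal \<bar>X t \<omega>\<bar>) + ennreal (B / (1 - \<rho>))"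
  proof -
    have "Lq_norm M q (\<lambda>\<omega>. ennreal (W \<omega>)) = Lq_norm M q (\<lambda>\<omega>. ennreal \<bar>X t \<omega>\<bar> + (\<Sum>k\<le>n. ennreal (R k \<omega>)))"
      by (simp add: W_def R_nonneg sum_nonneg)
    also have "\<dots> \<le> Lq_norm M q (\<lambda>\<omega>. ennreal \<bar>X t \<omega>\<bar>) + Lq_norm M q (\<lambda>\<omega>. \<Sum>k\<le>n. ennreal (R k \<omega>))"
      using q by (intro Lq_norm_triangle) auto
    also have "Lq_norm M q (\<lambda>\<omega>. \<Sum>k\<le>n. ennreal (R k \<omega>)) \<le> (\<Sum>k\<le>n. Lq_norm M q (\<lambda>\<omega>. ennreal (R k \<omega>)))"
      using q by (intro Lq_norm_sum) auto
    also have "\<dots> \<le> (\<Sum>k\<le>n. ennreal (B * \<rho> ^ k))"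
      using q by (intro sum_mono order_trans[OF Lq_norm_mono_exponent R_norm]) auto
    also have "\<dots> = ennreal (B * (\<Sum>k\<le>n. \<rho> ^ k))"
      using B \<rho> by (simp add: sum_distrib_left)
    also have "\<dots> \<le> ennreal (B / (1 - \<rho>))"
    proof (rule ennreal_leI)
      have "(\<Sum>k\<le>n. \<rho> ^ k) = (1 - \<rho> ^ Suc n) / (1 - \<rho>)"
        using \<rho> by (simp add: sum_gp0)
      also have "\<dots> \<le> 1 / (1 - \<rho>)" using \<rho> by (intro divide_right_mono) auto
      finally have "B * (\<Sum>k\<le>n. \<rho> ^ k) \<le> B * (1 / (1 - \<rho>))" using B by (rule mult_left_mono)
      then show "B * (\<Sum>k\<le>n. \<rho> ^ k) \<le> B / (1 - \<rho>)" by simp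
    qed
    finally show ?thesis by (simp add: add_left_mono)
  qed
  also have "ennreal (q / (q - 1)) * (Lq_norm M q (\<lambda>\<omega>. ennreal \<bar>X t \<omega>\<bar>) + ennreal (B / (1 - \<rho>))) + ennreal (q / (q - 1)) * ennreal B
      = ennreal (q / (q - 1)) * (ennreal (B / (1 - \<rho>) + B) + Lq_norm M q (\<lambda>\<omega>. ennreal \<bar>X t \<omega>\<bar>))"
    using B \<rho> by (simp add: distrib_left ac_simps)
  also have "B / (1 - \<rho>) + B = B * (1 / (1 - \<rho>) + 1)" by (simp add: distrib_left)
  finally show ?thesis by (simp add: mult_left_mono add_right_mono)
qed

section \<open>The constant\<close>

text \<open>The lower bound is uniform in \<open>a\<close>, so that \<open>\<kappa>\<close> can be chosen independently of \<open>\<theta>\<close>: on \<open>[1/b, 1/b + 1]\<close>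
  the factor \<open>(b t)\<^bsup>a-1\<^esup>\<close> of the integrand is at least \<open>1\<close>.\<close>

lemma exp_le_powr_times_Gamma:
  fixes a b :: real
  assumes b: "0 < b" and a: "1 \<le> a"
  shows "exp (- (1 / b + 1)) \<le> b powr (a - 1) * Gamma a"
proof -
  \<comment> \<open>\<open>?c\<close> takes the power at the left end of the interval and the
    exponential at the right end. It bounds the Gamma integrand from below on an interval of length
    1, hence also its integral.\<close>
  let ?f = "\<lambda>t. t powr (a - 1) / exp t" and ?c = "(1 / b) powr (a - 1) / exp (1 / b + 1)"
  have "((\<lambda>t. ?c) has_integral ?c) {1 / b..1 / b + 1}"
    using has_integral_const_real[of ?c "1 / b" "1 / b + 1"] by simp
  moreover have int: "?f integrable_on {1 / b..1 / b + 1}"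
    using b by (intro integrable_continuous_real continuous_intros) auto
  ultimately have "?c \<le> integral {1 / b..1 / b + 1} ?f"
  proof (rule has_integral_le[OF _ integrable_integral])
    fix t assume t: "t \<in> {1 / b..1 / b + 1}"
    then have "(1 / b) powr (a - 1) \<le> t powr (a - 1)" using a b by (intro powr_mono2) auto
    then show "?c \<le> ?f t" using t by (intro frac_le) auto
  qed
  also have "\<dots> \<le> integral {0..} ?f"
    using b a Gamma_integral_real[of a] by (intro integral_subset_le int) (auto simp: has_integral_integrable)
  also have "\<dots> = Gamma a" using a Gamma_integral_real[of a] by (intro integral_unique) auto
  finally have "b powr (a - 1) * ?c \<le> b powr (a - 1) * Gamma a" by (intro mult_left_mono) auto
  moreover have "b powr (a - 1) * ?c = exp (- (1 / b + 1))"
  proof -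
    have "exp (- (1 / b + 1)) = 1 / exp (1 / b + 1)" by (simp only: exp_minus inverse_eq_divide)
    then show ?thesis using b by (simp add: powr_divide)
  qed
  ultimately show ?thesis by simp
qed

lemma riemann_zeta_ge_1:
  assumes "1 < \<theta>"
  shows "1 \<le> riemann_zeta \<theta>"
proof -
  have "summable (\<lambda>m. real (Suc m) powr (- \<theta>))"
    using assms by (subst summable_Suc_iff[of "\<lambda>m. real m powr (- \<theta>)"]) (simp add: summable_real_powr_iff)
  then have "(\<Sum>m<1. real (Suc m) powr (- \<theta>)) \<le> riemann_zeta \<theta>"
    unfolding riemann_zeta_def by (intro sum_le_suminf) auto
  then show ?thesis by simp
qed

text \<open>As \<open>e = p * h - 1\<close> tends to 0, the geometric sum grows like
  \<open>1 / e\<close>, hence its \<open>p\<close>-th power like \<open>e powr (- p)\<close>, while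
  the constant contains \<open>4 / e\<close> to the larger power
  \<open>a = \<theta> * (p - 1) + 1\<close>. The zeta factor and the power of
  \<open>p / (p - 1)\<close> are at least 1.\<close>

lemma C_const_lower_bound:
  fixes p :: real
  assumes p: "1 < p"
  shows "\<exists>\<kappa>>0. \<forall>h \<theta>. h \<le> 1 \<longrightarrow> 1 < p * h \<longrightarrow> 1 < \<theta> \<longrightarrow>
    1 / (1 - 2 powr (- (p * h - 1) / p)) + 1 \<le> C_const \<kappa> p h \<theta> powr (1 / p)"
proof -
  \<comment> \<open>A lower bound for \<open>4 / e\<close>, because \<open>h \<le> 1\<close> gives
    \<open>e \<le> p - 1\<close>. Replacing the surplus power \<open>a - p\<close> of
    \<open>4 / e\<close> by that of \<open>c\<close> lets the Gamma estimate with
    \<open>b = c\<close> remove \<open>\<theta>\<close>.\<close>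
  define c where "c = 4 / (p - 1)"
  define K where "K = c powr (1 - p) * exp (- (1 / c + 1))"
  have c: "0 < c" using p by (simp add: c_def)
  then have K: "0 < K" by (simp add: K_def)
  \<comment> \<open>Solves
    \<open>(3 * p / e) powr p = \<kappa> * ((4 / e) powr p * K)\<close>.\<close>
  define \<kappa> where "\<kappa> = (3 * p) powr p / (4 powr p * K)"
  have \<kappa>: "0 < \<kappa>" using p K by (simp add: \<kappa>_def)
  have "1 / (1 - 2 powr (- (p * h - 1) / p)) + 1 \<le> C_const \<kappa> p h \<theta> powr (1 / p)"
    if h: "h \<le> 1" "1 < p * h" and \<theta>: "1 < \<theta>" for h \<theta>
  proof -
    define e where "e = p * h - 1"
    define a where "a = \<theta> * (p - 1) + 1"
    have "p * h \<le> p * 1" using p h by (intro mult_left_mono) auto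
    then have e: "0 < e" "e \<le> p - 1" using h by (auto simp: e_def)
    have "1 * (p - 1) < \<theta> * (p - 1)" using p \<theta> by (intro mult_strict_right_mono) auto
    then have a: "p < a" by (simp add: a_def)
    have x: "0 < e / p" "e / p \<le> 1" using e p by auto
    \<comment> \<open>Young's inequality as convexity: \<open>2 powr (- x) \<le> 1 - x / 2\<close>
      for \<open>x = e / p\<close> in the unit interval.\<close>
    have "(1 / 2) powr (e / p) * 1 powr (1 - e / p) \<le> e / p * (1 / 2) + (1 - e / p) * 1"
      using x by (intro Youngs_inequality_0) auto
    moreover have "(1 / 2 :: real) powr (e / p) = 2 powr (- (p * h - 1) / p)"
      by (simp add: powr_divide e_def powr_minus_divide del: minus_diff_eq)
    ultimately have "e / p / 2 \<le> 1 - 2 powr (- (p * h - 1) / p)" by simp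
    then have "1 / (1 - 2 powr (- (p * h - 1) / p)) \<le> 1 / (e / p / 2)"
      using x by (intro divide_left_mono mult_pos_pos) auto
    \<comment> \<open>The geometric sum is at most \<open>2 * p / e\<close>; the summand 1 is at
      most \<open>p / e\<close>, whence the factor 3.\<close>
    moreover have "1 \<le> 1 / (e / p)" using e by simp
    ultimately have *: "1 / (1 - 2 powr (- (p * h - 1) / p)) + 1 \<le> 3 * p / e" by simp
    have "(4 / e) powr p * K = (4 / e) powr p * c powr (1 - p) * exp (- (1 / c + 1))"
      by (simp add: K_def)
    also have "\<dots> \<le> (4 / e) powr p * c powr (1 - p) * (c powr (a - 1) * Gamma a)"
      using c a p by (intro mult_left_mono exp_le_powr_times_Gamma) auto
    also have "\<dots> = (4 / e) powr p * c powr (a - p) * Gamma a"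
      using c by (simp flip: powr_add)
    also have "\<dots> \<le> (4 / e) powr p * (4 / e) powr (a - p) * Gamma a"
      using e a p Gamma_real_pos[of a]
      by (intro mult_left_mono mult_right_mono powr_mono2) (auto simp: c_def intro!: divide_left_mono)
    also have "\<dots> = (4 / e) powr a * Gamma a"
      using e by (simp flip: powr_add)
    finally have G: "(4 / e) powr p * K \<le> (4 / e) powr a * Gamma a" .
    have Z: "1 \<le> (2 * riemann_zeta \<theta>) powr (p - 1)"
      using riemann_zeta_ge_1[OF \<theta>] p by (intro ge_one_powr_ge_zero) auto
    have P: "1 \<le> (p / (p - 1)) powr p"
      using p by (intro ge_one_powr_ge_zero) auto
    have "(3 * p / e) powr p = \<kappa> * 1 * 1 * ((4 / e) powr p * K)"
      using p e K by (simp add: \<kappa>_def powr_divide)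
    also have "\<dots> \<le> \<kappa> * (2 * riemann_zeta \<theta>) powr (p - 1) * (p / (p - 1)) powr p * ((4 / e) powr a * Gamma a)"
      using \<kappa> Z P K by (intro mult_mono[OF mult_mono[OF mult_mono[OF order_refl Z] P] G]) auto
    also have "\<dots> = C_const \<kappa> p h \<theta>"
      by (simp add: C_const_def e_def a_def mult.assoc)
    finally have "((3 * p / e) powr p) powr (1 / p) \<le> C_const \<kappa> p h \<theta> powr (1 / p)"
      using p by (intro powr_mono2) auto
    then show ?thesis using * p e by (simp add: powr_powr)
  qed
  then show ?thesis using \<kappa> by blast
qed

section \<open>From finite sets of times to the interval\<close>

text \<open>Over the open interval, the points whose modulus exceeds the supremum over
  \<open>E\<close> form an open set that misses the graph over \<open>D\<close>, hence also its
  closure. The end points belong to \<open>E\<close> because points of \<open>D\<close> approaching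
  them may lie outside \<open>{s..t}\<close>.\<close>

lemma separable_process_countable_SUP:
  assumes sep: "separable_process M T X" and st: "0 \<le> s" "s \<le> t" "t \<le> T"
  obtains E where "countable E" "E \<subseteq> {s..t}"
    "AE \<omega> in M. (SUP u\<in>{s..t}. ennreal \<bar>X u \<omega>\<bar>) \<le> (SUP u\<in>E. ennreal \<bar>X u \<omega>\<bar>)"
proof -
  obtain D where D: "countable D"
    and ae: "AE \<omega> in M. \<forall>u\<in>{0..T}. (u, X u \<omega>) \<in> closure ((\<lambda>d. (d, X d \<omega>)) ` D)"
    using sep by (auto simp: separable_process_def)
  define E where "E = {s, t} \<union> (D \<inter> {s..t})"
  from ae have "AE \<omega> in M. (SUP u\<in>{s..t}. ennreal \<bar>X u \<omega>\<bar>) \<le> (SUP u\<in>E. ennreal \<bar>X u \<omega>\<bar>)"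
  proof eventually_elim
    case (elim \<omega>)
    let ?z = "SUP u\<in>E. ennreal \<bar>X u \<omega>\<bar>" and ?G = "(\<lambda>d. (d, X d \<omega>)) ` D"
    let ?V = "{s<..<t} \<times> {y :: real. ?z < ennreal \<bar>y\<bar>}"
    have "open ?V"
      by (intro open_Times open_Collect_less continuous_on_ennreal continuous_intros)
    moreover have "?V \<inter> ?G = {}"
    proof -
      have "ennreal \<bar>X d \<omega>\<bar> \<le> ?z" if "d \<in> D" "s < d" "d < t" for d
        using that by (intro SUP_upper) (auto simp: E_def)
      then show ?thesis by (auto simp: not_less[symmetric])
    qed
    ultimately have V: "?V \<inter> closure ?G = {}" by (simp add: open_Int_closure_eq_empty)
    show ?case
    proof (rule SUP_least)
      fix u assume u: "u \<in> {s..t}"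
      show "ennreal \<bar>X u \<omega>\<bar> \<le> ?z"
      proof (cases "u \<in> {s, t}")
        case True then show ?thesis by (intro SUP_upper) (auto simp: E_def)
      next
        case False
        moreover have "(u, X u \<omega>) \<in> closure ?G" using elim u st by auto
        then have "(u, X u \<omega>) \<notin> ?V" using V by blast
        ultimately show ?thesis using u by (auto simp: not_less)
      qed
    qed
  qed
  moreover have "countable E" "E \<subseteq> {s..t}" using D st by (auto simp: E_def)
  ultimately show ?thesis using that by blast
qed

theorem proposition1p1:
  fixes p :: real
  assumes "1 < p"
  shows "\<exists>\<kappa>>0. \<forall>(h::real) (T::real) (A::real) (M::'a measure) (F::real \<Rightarrow> 'a measure)
           (X::real \<Rightarrow> 'a \<Rightarrow> real) (s\<^sub>0::real) (t\<^sub>0::real) (q::real) (\<theta>::real).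
     0 < h \<longrightarrow> h \<le> 1 \<longrightarrow> 1 < p * h \<longrightarrow> 0 < T \<longrightarrow> 0 \<le> A \<longrightarrow>
     usual_filtered_prob_space M T F \<longrightarrow>
     (\<forall>t\<in>{0..T}. integrable M (X t)) \<longrightarrow>
     separable_process M T X \<longrightarrow>
     (\<forall>s t. 0 \<le> s \<and> s < t \<and> t \<le> T \<longrightarrow>
        (\<integral>\<^sup>+ \<omega>. ennreal (\<bar>real_cond_exp M (F s) (X t) \<omega> - X s \<omega>\<bar> powr p) \<partial>M)
          \<le> ennreal (A * \<bar>t - s\<bar> powr (p * h))) \<longrightarrow>
     0 \<le> s\<^sub>0 \<longrightarrow> s\<^sub>0 < t\<^sub>0 \<longrightarrow> t\<^sub>0 \<le> T \<longrightarrow> 1 < q \<longrightarrow> q \<le> p \<longrightarrow> 1 < \<theta> \<longrightarrow>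
     Lq_norm M q (\<lambda>\<omega>. SUP u\<in>{s\<^sub>0..t\<^sub>0}. ennreal \<bar>X u \<omega>\<bar>)
       \<le> ennreal (q / (q - 1)) *
          (ennreal (C_const \<kappa> p h \<theta> powr (1 / p) * A powr (1 / p) * \<bar>t\<^sub>0 - s\<^sub>0\<bar> powr h)
            + Lq_norm M q (\<lambda>\<omega>. ennreal \<bar>X t\<^sub>0 \<omega>\<bar>))"
proof -
  obtain \<kappa> where \<kappa>: "0 < \<kappa>" and C: "\<And>h \<theta>. h \<le> 1 \<Longrightarrow> 1 < p * h \<Longrightarrow> 1 < \<theta> \<Longrightarrow>
    1 / (1 - 2 powr (- (p * h - 1) / p)) + 1 \<le> C_const \<kappa> p h \<theta> powr (1 / p)"
    using C_const_lower_bound[OF assms] by blast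
  show ?thesis
  proof (intro exI[of _ \<kappa>] conjI \<kappa> allI impI)
    fix h T A :: real and M :: "'a measure" and F :: "real \<Rightarrow> 'a measure" and X :: "real \<Rightarrow> 'a \<Rightarrow> real"
      and s t q \<theta> :: real
    assume h: "0 < h" "h \<le> 1" "1 < p * h" and "0 < T" and A: "0 \<le> A"
      and filt: "usual_filtered_prob_space M T F"
      and X: "\<forall>t\<in>{0..T}. integrable M (X t)"
      and sep: "separable_process M T X"
      and D: "\<forall>s t. 0 \<le> s \<and> s < t \<and> t \<le> T \<longrightarrow>
        (\<integral>\<^sup>+ \<omega>. ennreal (\<bar>real_cond_exp M (F s) (X t) \<omega> - X s \<omega>\<bar> powr p) \<partial>M)
          \<le> ennreal (A * \<bar>t - s\<bar> powr (p * h))"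
      and st: "0 \<le> s" "s < t" "t \<le> T" and q: "1 < q" "q \<le> p" and \<theta>: "1 < \<theta>"
    interpret prob_space M using filt by (simp add: usual_filtered_prob_space_def)
    have sub: "subalgebra M (F u)" if "u \<in> {s..t}" for u
      using filt that st by (auto simp: usual_filtered_prob_space_def)
    have mono: "sets (F u) \<subseteq> sets (F v)" if "s \<le> u" "u \<le> v" "v \<le> t" for u v
      using filt that st by (simp add: usual_filtered_prob_space_def)
    have intX: "integrable M (X u)" if "u \<in> {s..t}" for u using X st that by auto
    \<comment> \<open>Changing the filtration at the final time makes \<open>X t\<close> measurable with respect to it; the hypothesis only uses \<open>F u\<close> with \<open>u < t\<close>.\<close>
    define F' where "F' = F(t := M)"
    define B where "B = A powr (1 / p) * (t - s) powr h * (1 / (1 - 2 powr (- (p * h - 1) / p)) + 1)"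
    have fin: "Lq_norm M q (\<lambda>\<omega>. SUP u\<in>U. ennreal \<bar>X u \<omega>\<bar>)
        \<le> ennreal (q / (q - 1)) * (ennreal B + Lq_norm M q (\<lambda>\<omega>. ennreal \<bar>X t \<omega>\<bar>))"
      if U: "finite U" "U \<subseteq> {s..t}" for U
      unfolding B_def
    proof (rule Lq_norm_finite_sup[OF assms h(1,3) A st(2) _ _ intX _ _ q U])
      show "subalgebra M (F' u)" if "u \<in> {s..t}" for u
        using sub[OF that] by (simp add: F'_def subalgebra_def)
      show "sets (F' u) \<subseteq> sets (F' v)" if "s \<le> u" "u \<le> v" "v \<le> t" for u v
        using mono[OF that] sub[of u] that by (auto simp: F'_def subalgebra_def)
      show "X t \<in> borel_measurable (F' t)" using intX[of t] st by (simp add: F'_def)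
      show "(\<integral>\<^sup>+ \<omega>. ennreal (\<bar>real_cond_exp M (F' u) (X v) \<omega> - X u \<omega>\<bar> powr p) \<partial>M)
          \<le> ennreal (A * (v - u) powr (p * h))" if "s \<le> u" "u < v" "v \<le> t" for u v
        using D[rule_format, of u v] that st by (simp add: F'_def)
    qed
    obtain E where E: "countable E" "E \<subseteq> {s..t}"
      and le: "AE \<omega> in M. (SUP u\<in>{s..t}. ennreal \<bar>X u \<omega>\<bar>) \<le> (SUP u\<in>E. ennreal \<bar>X u \<omega>\<bar>)"
      using separable_process_countable_SUP[OF sep, of s t] st by auto
    have "Lq_norm M q (\<lambda>\<omega>. SUP u\<in>{s..t}. ennreal \<bar>X u \<omega>\<bar>) \<le> Lq_norm M q (\<lambda>\<omega>. SUP u\<in>E. ennreal \<bar>X u \<omega>\<bar>)"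
      using le q by (intro Lq_norm_mono_AE) auto
    also have "\<dots> \<le> ennreal (q / (q - 1)) * (ennreal B + Lq_norm M q (\<lambda>\<omega>. ennreal \<bar>X t \<omega>\<bar>))"
    proof (rule Lq_norm_SUP_countable_le[OF _ E(1)])
      show "(\<lambda>\<omega>. ennreal \<bar>X u \<omega>\<bar>) \<in> borel_measurable M" if "u \<in> E" for u
      proof -
        have [measurable]: "X u \<in> borel_measurable M" using intX that E by blast
        show ?thesis by measurable
      qed
    qed (use fin E q in auto)
    also have "ennreal B \<le> ennreal (C_const \<kappa> p h \<theta> powr (1 / p) * A powr (1 / p) * \<bar>t - s\<bar> powr h)"
    proof (rule ennreal_leI)
      have "A powr (1 / p) * (t - s) powr h * (1 / (1 - 2 powr (- (p * h - 1) / p)) + 1)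
          \<le> A powr (1 / p) * (t - s) powr h * C_const \<kappa> p h \<theta> powr (1 / p)"
        by (intro mult_left_mono C h \<theta>) auto
      then show "B \<le> C_const \<kappa> p h \<theta> powr (1 / p) * A powr (1 / p) * \<bar>t - s\<bar> powr h"
        using st by (simp add: B_def mult_ac)
    qed
    finally show "Lq_norm M q (\<lambda>\<omega>. SUP u\<in>{s..t}. ennreal \<bar>X u \<omega>\<bar>)
        \<le> ennreal (q / (q - 1)) *
          (ennreal (C_const \<kappa> p h \<theta> powr (1 / p) * A powr (1 / p) * \<bar>t - s\<bar> powr h)
            + Lq_norm M q (\<lambda>\<omega>. ennreal \<bar>X t \<omega>\<bar>))"
      by (simp add: mult_left_mono add_right_mono)
  qed
qed

end
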